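(* Let $R$ be a commutative ring with identity, and let $R[x]$ be the polynomial ring in one indeterminate $x$ over $R$. Then $R$ is an FGFC-ring if and only if $R[x]$ is an FGFC-ring.
   Context: All rings are commutative with identity. For a ring $A$ and an $A$-module $M$, let $\operatorname{Supp}_A M$ denote the support of $M$ and let $\operatorname{Min}_A M$ denote the set of minimal elements (with respect to inclusion) of $\operatorname{Supp}_A M$. An $A$-module $M$ is said to be FGFC if for every finitely generated $A$-submodule $N$ of $M$, $\operatorname{Supp}_A (M/N)$ is a finite union of irreducible closed subsets of $\operatorname{Spec} A$; equivalently, $\operatorname{Min}_A (M/N)$ is a finite set. A ring $A$ is an FGFC-ring if it is FGFC as an $A$-module; that is, for every finitely generated ideal $I$ of $A$, the set of primes of $A$ minimal over $I$ is finite. *)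

theory Defs
  imports
    "HOL-Analysis.Abstract_Topology"
    "HOL-Algebra.Module"
    "HOL-Algebra.Ideal"
    "HOL-Algebra.UnivPoly"
begin

section \<open>The spectrum of a ring\<close>

definition Spec :: "('a, 'c) ring_scheme \<Rightarrow> 'a set set"
  where "Spec A = {p. primeideal p A}"

definition zero_locus :: "('a, 'c) ring_scheme \<Rightarrow> 'a set \<Rightarrow> 'a set set"
  where "zero_locus A E = {p \<in> Spec A. E \<subseteq> p}"

definition zariski :: "('a, 'c) ring_scheme \<Rightarrow> 'a set topology"
  where "zariski A = topology (\<lambda>U. \<exists>E \<subseteq> carrier A. U = Spec A - zero_locus A E)"

text \<open>The empty set is not irreducible.\<close>

definition irreducible_in :: "'a topology \<Rightarrow> 'a set \<Rightarrow> bool"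
  where "irreducible_in X S \<longleftrightarrow> S \<subseteq> topspace X \<and> S \<noteq> {} \<and>
    (\<forall>C D. closedin X C \<and> closedin X D \<and> S \<subseteq> C \<union> D \<longrightarrow> S \<subseteq> C \<or> S \<subseteq> D)"

section \<open>Modules\<close>

text \<open>The ring \<open>A\<close> as a module over itself.\<close>

definition regular_module :: "('a, 'c) ring_scheme \<Rightarrow> ('a, 'a) module"
  where "regular_module A =
    \<lparr>carrier = carrier A, mult = mult A, one = one A, zero = zero A, add = add A,
     smult = mult A\<rparr>"

definition generated_submodule ::
    "('a, 'c) ring_scheme \<Rightarrow> ('a, 'b, 'd) module_scheme \<Rightarrow> 'b set \<Rightarrow> 'b set"
  where "generated_submodule A M S = \<Inter>{N. submodule N A M \<and> S \<subseteq> N}"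

definition fg_submodule ::
    "'b set \<Rightarrow> ('a, 'c) ring_scheme \<Rightarrow> ('a, 'b, 'd) module_scheme \<Rightarrow> bool"
  where "fg_submodule N A M \<longleftrightarrow>
    (\<exists>S. finite S \<and> S \<subseteq> carrier M \<and> N = generated_submodule A M S)"

text \<open>The module \<open>M/N\<close>. The fields \<open>mult\<close> and \<open>one\<close>, which the record type inherits from rings,
  play no role in a module.\<close>

definition quotient_module ::
    "('a, 'c) ring_scheme \<Rightarrow> ('a, 'b, 'd) module_scheme \<Rightarrow> 'b set \<Rightarrow> ('a, 'b set) module"
  where "quotient_module A M N =
    \<lparr>carrier = a_rcosets\<^bsub>M\<^esub> N, mult = undefined, one = undefined, zero = N, add = set_add M,
     smult = (\<lambda>a X. \<Union>x\<in>X. N +>\<^bsub>M\<^esub> (a \<odot>\<^bsub>M\<^esub> x))\<rparr>"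

text \<open>The fractions \<open>m/s\<close> and \<open>m'/s'\<close> agree in \<open>M\<^sub>p\<close> iff \<open>u s' m = u s m'\<close>
  for some \<open>u\<close> outside \<open>p\<close>.\<close>

definition fraction_rel ::
    "('a, 'c) ring_scheme \<Rightarrow> ('a, 'b, 'd) module_scheme \<Rightarrow> 'a set \<Rightarrow> (('b \<times> 'a) \<times> ('b \<times> 'a)) set"
  where "fraction_rel A M p =
    {((m, s), (m', s')). m \<in> carrier M \<and> m' \<in> carrier M \<and>
       s \<in> carrier A - p \<and> s' \<in> carrier A - p \<and>
       (\<exists>u \<in> carrier A - p. u \<odot>\<^bsub>M\<^esub> (s' \<odot>\<^bsub>M\<^esub> m) = u \<odot>\<^bsub>M\<^esub> (s \<odot>\<^bsub>M\<^esub> m'))}"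

definition localization ::
    "('a, 'c) ring_scheme \<Rightarrow> ('a, 'b, 'd) module_scheme \<Rightarrow> 'a set \<Rightarrow> ('b \<times> 'a) set set"
  where "localization A M p = (carrier M \<times> (carrier A - p)) // fraction_rel A M p"

definition localization_zero ::
    "('a, 'c) ring_scheme \<Rightarrow> ('a, 'b, 'd) module_scheme \<Rightarrow> 'a set \<Rightarrow> ('b \<times> 'a) set"
  where "localization_zero A M p = fraction_rel A M p `` {(\<zero>\<^bsub>M\<^esub>, \<one>\<^bsub>A\<^esub>)}"

definition Supp :: "('a, 'c) ring_scheme \<Rightarrow> ('a, 'b, 'd) module_scheme \<Rightarrow> 'a set set"
  where "Supp A M = {p \<in> Spec A. localization A M p \<noteq> {localization_zero A M p}}"

section \<open>FGFC modules and rings\<close>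

definition FGFC_module :: "('a, 'c) ring_scheme \<Rightarrow> ('a, 'b, 'd) module_scheme \<Rightarrow> bool"
  where "FGFC_module A M \<longleftrightarrow>
    (\<forall>N. fg_submodule N A M \<longrightarrow>
      (\<exists>F. finite F \<and>
        (\<forall>C \<in> F. closedin (zariski A) C \<and> irreducible_in (zariski A) C) \<and>
        Supp A (quotient_module A M N) = \<Union>F))"

definition FGFC_ring :: "('a, 'c) ring_scheme \<Rightarrow> bool"
  where "FGFC_ring A \<longleftrightarrow> FGFC_module A (regular_module A)"

end

theory Submission
  imports Defs "HOL-Algebra.QuotRing"
begin

text \<open>
  \<open>FGFC\<close> for a ring means: for every finite set \<open>S\<close> there are finitely many primes containing \<open>S\<close>
  such that every prime containing \<open>S\<close> lies above one of them. Contraction of primes along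
  \<open>R \<rightarrow> R[x]\<close>, with \<open>x \<mapsto> 0\<close> as a retraction, carries this from \<open>R[x]\<close> to \<open>R\<close>.

  Conversely, pseudo-division and splitting along leading coefficients reduce a finite set of
  polynomials to constants together with at most one nonconstant polynomial \<open>f\<close>, on the open set
  where the leading coefficient \<open>a\<close> of \<open>f\<close> does not vanish. A prime \<open>Q\<close> there lies above one of the
  finitely many primes \<open>p\<close> of \<open>R\<close> minimal over the constants. Over the domain \<open>R/p\<close>, it
  contains the contraction of \<open>(g)\<close> for one of the irreducible factors \<open>g\<close> of \<open>f\<close> over the field of
  fractions: a product of elements outside \<open>Q\<close>, one from each contraction, would be divisible by \<open>f\<close>
  over the field of fractions, hence after inverting \<open>a\<close> alone, and so would lie in \<open>Q\<close>.
\<close>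

section \<open>FGFC rings and minimal primes\<close>

text \<open>Members of \<open>F\<close> may fail to be minimal, but every prime minimal over
  \<open>S\<close> must be one of them; conversely, the minimal members of \<open>F\<close> are
  minimal over \<open>S\<close>. So the primes minimal over \<open>S\<close> are finite in number,
  and their existence below every prime over \<open>S\<close> is built in.\<close>

definition finite_min_primes :: "('a, 'c) ring_scheme \<Rightarrow> 'a set \<Rightarrow> bool"
  where "finite_min_primes A S \<longleftrightarrow>
    (\<exists>F. finite F \<and> F \<subseteq> zero_locus A S \<and> (\<forall>P \<in> zero_locus A S. \<exists>Q \<in> F. Q \<subseteq> P))"

lemma zero_locus_iff: "P \<in> zero_locus A S \<longleftrightarrow> primeideal P A \<and> S \<subseteq> P"
  by (auto simp: zero_locus_def Spec_def)

lemma primeideal_one_notin: "primeideal P A \<Longrightarrow> \<one>\<^bsub>A\<^esub> \<notin> P"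
  by (metis ideal.one_imp_carrier primeideal.I_notcarr primeideal_def)

lemma primeideal_subset: "primeideal P A \<Longrightarrow> P \<subseteq> carrier A"
  by (meson additive_subgroup.a_subset ideal_def primeideal_def)

lemma primeideal_nat_pow:
  assumes "primeideal P A" "a \<in> carrier A" "a [^]\<^bsub>A\<^esub> (k::nat) \<in> P"
  shows "a \<in> P"
proof -
  interpret primeideal P A by fact
  show ?thesis
    using assms(2,3)
  proof (induction k)
    case (Suc k)
    then show ?case using I_prime[of "a [^]\<^bsub>A\<^esub> k" a] by auto
  qed (use primeideal_one_notin[OF assms(1)] in auto)
qed

section \<open>The Zariski topology and its irreducible closed sets\<close>

context cring
begin

text \<open>A prime that misses some \<open>e\<close> in \<open>E\<close> and some \<open>e'\<close>
  in \<open>E'\<close> misses their product. This makes the open sets closed under binary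
  intersection.\<close>

lemma zero_locus_Un:
  assumes "E \<subseteq> carrier R" "E' \<subseteq> carrier R"
  shows "zero_locus R E \<union> zero_locus R E' = zero_locus R {e \<otimes> e' | e e'. e \<in> E \<and> e' \<in> E'}"
proof -
  have "E \<subseteq> P \<or> E' \<subseteq> P"
    if P: "primeideal P R" and sub: "{e \<otimes> e' | e e'. e \<in> E \<and> e' \<in> E'} \<subseteq> P" for P
    using assms sub primeideal.I_prime[OF P] by blast
  moreover have "{e \<otimes> e' | e e'. e \<in> E \<and> e' \<in> E'} \<subseteq> P" if P: "primeideal P R" "E \<subseteq> P \<or> E' \<subseteq> P" for P
  proof -
    interpret primeideal P R by fact
    show ?thesis using that(2) assms I_l_closed I_r_closed by blast
  qed
  ultimately show ?thesis unfolding set_eq_iff Un_iff zero_locus_iff by blast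
qed

text \<open>The constant \<open>topology\<close> returns the intended open sets only for a predicate
  that is a topology, so every fact about \<open>zariski\<close> rests on this.\<close>

lemma istopology_zariski: "istopology (\<lambda>U. \<exists>E \<subseteq> carrier R. U = Spec R - zero_locus R E)"
  unfolding istopology_def
proof (intro conjI allI impI)
  fix U V assume "\<exists>E \<subseteq> carrier R. U = Spec R - zero_locus R E" "\<exists>E \<subseteq> carrier R. V = Spec R - zero_locus R E"
  then obtain E E' where E: "E \<subseteq> carrier R" "U = Spec R - zero_locus R E"
    "E' \<subseteq> carrier R" "V = Spec R - zero_locus R E'" by blast
  show "\<exists>E \<subseteq> carrier R. U \<inter> V = Spec R - zero_locus R E"
    by (rule exI[of _ "{e \<otimes> e' | e e'. e \<in> E \<and> e' \<in> E'}"])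
      (use E in \<open>auto simp flip: zero_locus_Un\<close>)
next
  fix K assume "\<forall>U\<in>K. \<exists>E \<subseteq> carrier R. U = Spec R - zero_locus R E"
  then obtain f where f: "\<And>U. U \<in> K \<Longrightarrow> f U \<subseteq> carrier R \<and> U = Spec R - zero_locus R (f U)" by metis
  have "\<Union>K = (\<Union>U\<in>K. Spec R - zero_locus R (f U))" using f by auto
  also have "\<dots> = Spec R - zero_locus R (\<Union>(f ` K))" by (auto simp: zero_locus_def)
  finally show "\<exists>E \<subseteq> carrier R. \<Union>K = Spec R - zero_locus R E"
    using f by (intro exI[of _ "\<Union>(f ` K)"]) auto
qed

lemma topspace_zariski: "topspace (zariski R) = Spec R"
proof -
  \<comment> \<open>The whole spectrum is open because the zero locus of \<open>\<one>\<close> is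
    empty.\<close>
  have "Spec R - zero_locus R {\<one>} = Spec R" using primeideal_one_notin[of _ R] by (auto simp: zero_locus_iff)
  then show ?thesis
    by (auto simp: topspace_def zariski_def topology_inverse'[OF istopology_zariski] intro!: exI[of _ "Spec R"] exI[of _ "{\<one>}"])
qed

lemma closedin_zariski: "closedin (zariski R) C \<longleftrightarrow> (\<exists>E \<subseteq> carrier R. C = zero_locus R E)"
proof -
  have "zero_locus R E \<subseteq> Spec R" for E by (auto simp: zero_locus_def)
  then show ?thesis
    unfolding closedin_def topspace_zariski
    by (simp add: zariski_def topology_inverse'[OF istopology_zariski])
      (metis Diff_subset double_diff subset_refl)
qed

text \<open>\<open>P\<close> is a generic point: a closed set that contains \<open>P\<close>
  contains every prime above it.\<close>

lemma irreducible_in_zero_locus: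
  assumes "primeideal P R" shows "irreducible_in (zariski R) (zero_locus R P)"
proof -
  have "P \<in> zero_locus R P" using assms by (auto simp: zero_locus_iff)
  then show ?thesis
    unfolding irreducible_in_def topspace_zariski closedin_zariski
    by (fastforce simp: zero_locus_def)
qed

text \<open>If \<open>a \<otimes> b\<close> lies in every member of \<open>C\<close>, then the zero
  loci of \<open>a\<close> and \<open>b\<close> cover \<open>C\<close>, and irreducibility places
  \<open>C\<close> inside one of them. That \<open>C\<close> is nonempty makes the intersection
  proper.\<close>

lemma irreducible_closed_Inter:
  assumes "closedin (zariski R) C" "irreducible_in (zariski R) C"
  shows "primeideal (\<Inter>C) R" "C = zero_locus R (\<Inter>C)"
proof -
  obtain E where E: "E \<subseteq> carrier R" "C = zero_locus R E" using assms closedin_zariski by auto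
  have ne: "C \<noteq> {}" and irr: "\<And>D D'. \<lbrakk>closedin (zariski R) D; closedin (zariski R) D'; C \<subseteq> D \<union> D'\<rbrakk> \<Longrightarrow> C \<subseteq> D \<or> C \<subseteq> D'"
    using assms by (auto simp: irreducible_in_def)
  have pr: "\<And>P. P \<in> C \<Longrightarrow> primeideal P R" using E by (auto simp: zero_locus_iff)
  show "primeideal (\<Inter>C) R"
  proof (rule primeidealI)
    show "ideal (\<Inter>C) R" using ne pr primeideal.axioms(1) by (intro i_Intersect) auto
    show "carrier R \<noteq> \<Inter>C" using ne pr primeideal_one_notin by blast
    fix a b assume ab: "a \<in> carrier R" "b \<in> carrier R" "a \<otimes> b \<in> \<Inter>C"
    then have "C \<subseteq> zero_locus R {a} \<union> zero_locus R {b}"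
      using pr primeideal.I_prime by (fastforce simp: zero_locus_iff)
    moreover have "closedin (zariski R) (zero_locus R {a})" "closedin (zariski R) (zero_locus R {b})"
      using ab closedin_zariski by blast+
    ultimately show "a \<in> \<Inter>C \<or> b \<in> \<Inter>C" using irr by (fastforce simp: zero_locus_iff)
  qed (rule cring_axioms)
  show "C = zero_locus R (\<Inter>C)" using E \<open>primeideal (\<Inter>C) R\<close> unfolding set_eq_iff zero_locus_iff by blast
qed

text \<open>Irreducible closed sets correspond to primes: \<open>C\<close> goes to its intersection,
  and a prime \<open>Q\<close> to its zero locus.\<close>

lemma finite_irreducible_union_iff:
  "(\<exists>F. finite F \<and> (\<forall>C \<in> F. closedin (zariski R) C \<and> irreducible_in (zariski R) C) \<and> zero_locus R S = \<Union>F)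
    \<longleftrightarrow> finite_min_primes R S" (is "?L \<longleftrightarrow> ?R")
proof
  assume ?L
  then obtain F where F: "finite F" "zero_locus R S = \<Union>F"
    and irr: "\<And>C. C \<in> F \<Longrightarrow> primeideal (\<Inter>C) R \<and> C = zero_locus R (\<Inter>C)"
    using irreducible_closed_Inter by metis
  have "\<Inter>C \<in> zero_locus R S" if "C \<in> F" for C
    using irr[OF that] F(2) that by (metis UnionI order_refl zero_locus_iff)
  moreover have "\<exists>Q \<in> Inter ` F. Q \<subseteq> P" if "P \<in> zero_locus R S" for P
    using that unfolding F(2) by (metis Inter_lower UnionE imageI)
  ultimately show ?R unfolding finite_min_primes_def
    by (intro exI[of _ "Inter ` F"]) (use F in auto)
next
  assume ?R
  then obtain F where F: "finite F" "F \<subseteq> zero_locus R S" "\<And>P. P \<in> zero_locus R S \<Longrightarrow> \<exists>Q \<in> F. Q \<subseteq> P"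
    unfolding finite_min_primes_def by metis
  have pr: "\<And>P. P \<in> F \<Longrightarrow> primeideal P R" using F(2) by (auto simp: zero_locus_iff)
  show ?L
  proof (intro exI[of _ "zero_locus R ` F"] conjI ballI)
    show "zero_locus R S = \<Union>(zero_locus R ` F)"
      using F(2,3) unfolding set_eq_iff UN_iff zero_locus_iff by (meson order_trans subset_iff zero_locus_iff)
    show "closedin (zariski R) C" if "C \<in> zero_locus R ` F" for C
      using that pr primeideal_subset unfolding closedin_zariski by blast
    show "irreducible_in (zariski R) C" if "C \<in> zero_locus R ` F" for C
      using that pr irreducible_in_zero_locus by blast
  qed (use F in simp)
qed

section \<open>Supports of quotients of the regular module\<close>

lemma submodule_regular_iff: "submodule N R (regular_module R) \<longleftrightarrow> ideal N R"
proof
  assume N: "submodule N R (regular_module R)"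
  have cl: "a \<otimes> x \<in> N" if "a \<in> carrier R" "x \<in> N" for a x
    using submodule.smult_closed[OF N that] by (simp add: regular_module_def)
  have sub: "N \<subseteq> carrier R"
    using subgroup.subset[OF submodule.axioms(1)[OF N]] by (simp add: regular_module_def)
  show "ideal N R"
  proof (rule idealI)
    show "subgroup N (add_monoid R)"
      using submodule.axioms(1)[OF N] by (simp add: regular_module_def subgroup_def m_inv_def)
    show "a \<in> N \<Longrightarrow> x \<in> carrier R \<Longrightarrow> x \<otimes> a \<in> N" for a x using cl by auto
    show "a \<in> N \<Longrightarrow> x \<in> carrier R \<Longrightarrow> a \<otimes> x \<in> N" for a x using cl sub m_comm by (metis subsetD)
  qed (rule ring_axioms)
next
  assume "ideal N R"
  then interpret ideal N R .
  show "submodule N R (regular_module R)"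
    using a_subgroup
    by (auto simp: submodule_def submodule_axioms_def regular_module_def subgroup_def m_inv_def I_l_closed)
qed

lemma generated_submodule_regular:
  "generated_submodule R (regular_module R) S = genideal R S"
  unfolding generated_submodule_def submodule_regular_iff genideal_def by simp

text \<open>An element of \<open>N\<close> outside \<open>P\<close> annihilates the quotient and so
  identifies all fractions. Conversely, if the class of \<open>\<one>\<close> becomes zero in the
  localization, then some \<open>u\<close> outside \<open>P\<close> lies in
  \<open>N\<close>.\<close>

lemma Supp_quotient_regular:
  assumes "ideal N R"
  shows "Supp R (quotient_module R (regular_module R) N) = zero_locus R N"
proof -
  interpret ideal N R by fact
  define M where "M = quotient_module R (regular_module R) N"
  have cos: "a_r_coset (regular_module R) = a_r_coset R"
    by (intro ext) (simp add: regular_module_def a_r_coset_def r_coset_def)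
  have car: "carrier M = {N +> x | x. x \<in> carrier R}"
    by (auto simp: M_def quotient_module_def A_RCOSETS_def RCOSETS_def regular_module_def a_r_coset_def r_coset_def)
  have zero: "\<zero>\<^bsub>M\<^esub> = N" by (simp add: M_def quotient_module_def)
  have zc: "N \<in> carrier M" using car a_coset_add_zero a_subset zero_closed by blast
  \<comment> \<open>Scalar multiplication is a union over all representatives of a coset; each of
    them contributes the same coset, so the union collapses.\<close>
  have sm: "a \<odot>\<^bsub>M\<^esub> (N +> x) = N +> (a \<otimes> x)" if "a \<in> carrier R" "x \<in> carrier R" for a x
  proof -
    have "N +> (a \<otimes> y) = N +> (a \<otimes> x)" if y: "y \<in> N +> x" for y
    proof -
      obtain n where n: "n \<in> N" "y = n \<oplus> x" using y by (auto simp: a_r_coset_def r_coset_def)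
      then have "a \<otimes> y = a \<otimes> n \<oplus> a \<otimes> x" using that \<open>a \<in> carrier R\<close> \<open>x \<in> carrier R\<close> a_subset
        by (simp add: r_distr Icarr)
      moreover have "a \<otimes> n \<in> N" using n that I_l_closed \<open>a \<in> carrier R\<close> by blast
      ultimately have "a \<otimes> y \<in> N +> (a \<otimes> x)" by (auto simp: a_r_coset_def r_coset_def)
      then show ?thesis using a_repr_independence \<open>a \<in> carrier R\<close> \<open>x \<in> carrier R\<close> a_subgroup by (metis m_closed)
    qed
    moreover have "x \<in> N +> x" using that a_rcos_self by blast
    ultimately have "(\<Union>y \<in> N +> x. N +> (a \<otimes> y)) = N +> (a \<otimes> x)" by blast
    then show ?thesis
      unfolding M_def quotient_module_def cos by (simp add: regular_module_def)
  qed
  have "localization R M P \<noteq> {localization_zero R M P} \<longleftrightarrow> N \<subseteq> P" if P: "primeideal P R" for P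
  proof
    interpret P: primeideal P R by fact
    have oneP: "\<one> \<notin> P" using P by (rule primeideal_one_notin)
    show "N \<subseteq> P" if "localization R M P \<noteq> {localization_zero R M P}"
    proof (rule ccontr)
      assume "\<not> N \<subseteq> P"
      then obtain u where u: "u \<in> N" "u \<notin> P" by blast
      have uM: "u \<odot>\<^bsub>M\<^esub> m = N" if m: "m \<in> carrier M" for m
      proof -
        obtain x where x: "m = N +> x" "x \<in> carrier R" using m unfolding car by blast
        have "u \<otimes> x \<in> N" using u x by (simp add: I_r_closed)
        then show ?thesis using sm x u by (simp add: Icarr a_rcos_const)
      qed
      have smc: "a \<odot>\<^bsub>M\<^esub> m \<in> carrier M" if "a \<in> carrier R" "m \<in> carrier M" for a m
        using car sm that by auto
      \<comment> \<open>The annihilating \<open>u\<close> witnesses the equivalence of any two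
        fractions, which leaves a single class.\<close>
      have "fraction_rel R M P = (carrier M \<times> (carrier R - P)) \<times> (carrier M \<times> (carrier R - P))"
        using u smc uM Icarr by (auto simp: fraction_rel_def intro!: bexI[of _ u])
      then have "localization R M P = {carrier M \<times> (carrier R - P)}"
        "localization_zero R M P = carrier M \<times> (carrier R - P)"
        using zc zero oneP by (auto simp: localization_def localization_zero_def quotient_def)
      then show False using that by simp
    qed
    show "localization R M P \<noteq> {localization_zero R M P}" if "N \<subseteq> P"
    proof
      assume eq: "localization R M P = {localization_zero R M P}"
      have m1: "N +> \<one> \<in> carrier M" using car by auto
      then have "fraction_rel R M P `` {(N +> \<one>, \<one>)} \<in> localization R M P"
        using oneP by (auto simp: localization_def quotient_def)
      then have "fraction_rel R M P `` {(N +> \<one>, \<one>)} = fraction_rel R M P `` {(N, \<one>)}"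
        using eq zero by (simp add: localization_zero_def)
      moreover have "((N +> \<one>, \<one>), (N +> \<one>, \<one>)) \<in> fraction_rel R M P"
        using m1 oneP by (auto simp: fraction_rel_def)
      ultimately have "((N, \<one>), (N +> \<one>, \<one>)) \<in> fraction_rel R M P" by auto
      then obtain u where u: "u \<in> carrier R" "u \<notin> P" "u \<odot>\<^bsub>M\<^esub> (\<one> \<odot>\<^bsub>M\<^esub> N) = u \<odot>\<^bsub>M\<^esub> (\<one> \<odot>\<^bsub>M\<^esub> (N +> \<one>))"
        by (auto simp: fraction_rel_def)
      have N0: "N = N +> \<zero>" using a_coset_add_zero a_subset by simp
      have "N = N +> u" using u(1,3) N0 sm[of \<one> \<zero>] sm[of u \<zero>] sm[of \<one> \<one>] sm[of u \<one>] by simp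
      then have "u \<in> N" using a_rcos_self u(1) by blast
      then show False using u that by blast
    qed
  qed
  then show ?thesis unfolding Supp_def M_def[symmetric] zero_locus_def Spec_def by blast
qed

lemma FGFC_ring_iff:
  "FGFC_ring R \<longleftrightarrow> (\<forall>S. finite S \<and> S \<subseteq> carrier R \<longrightarrow> finite_min_primes R S)"
proof -
  \<comment> \<open>A prime is an ideal, so it contains \<open>S\<close> exactly when it contains
    the ideal generated by \<open>S\<close>.\<close>
  have "zero_locus R (genideal R S) = zero_locus R S" if "S \<subseteq> carrier R" for S
    unfolding set_eq_iff zero_locus_iff
    by (meson that genideal_self genideal_minimal primeideal.axioms(1) order_trans)
  then have *: "Supp R (quotient_module R (regular_module R) (genideal R S)) = zero_locus R S"
    if "S \<subseteq> carrier R" for S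
    using Supp_quotient_regular genideal_ideal that by simp
  have car: "carrier (regular_module R) = carrier R" by (simp add: regular_module_def)
  have gen: "(\<forall>N. (\<exists>S. f S \<and> h S \<and> N = g S) \<longrightarrow> Q N) \<longleftrightarrow> (\<forall>S. f S \<and> h S \<longrightarrow> Q (g S))"
    for f h :: "'a set \<Rightarrow> bool" and g and Q :: "'a set \<Rightarrow> bool" by auto
  have "FGFC_ring R \<longleftrightarrow> (\<forall>S. finite S \<and> S \<subseteq> carrier R \<longrightarrow>
      (\<exists>F. finite F \<and> (\<forall>C \<in> F. closedin (zariski R) C \<and> irreducible_in (zariski R) C) \<and>
        Supp R (quotient_module R (regular_module R) (genideal R S)) = \<Union>F))"
    unfolding FGFC_ring_def FGFC_module_def fg_submodule_def generated_submodule_regular car by (rule gen)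
  then show ?thesis
    unfolding finite_irreducible_union_iff[symmetric] by (simp add: * cong: conj_cong imp_cong)
qed

end

section \<open>Polynomials over a domain\<close>

text \<open>The scalar factor of \<open>long_div_theorem\<close> becomes a power of a constant
  polynomial, so that it can be tested for membership in primes of \<open>P\<close>. The coefficient
  ring is an arbitrary commutative ring.\<close>

lemma (in UP_cring) pseudo_division:
  assumes "f \<in> carrier P" "g \<in> carrier P" "g \<noteq> \<zero>\<^bsub>P\<^esub>"
  obtains q r and k :: nat where "q \<in> carrier P" "r \<in> carrier P"
    "monom P (lcoeff g) 0 [^]\<^bsub>P\<^esub> k \<otimes>\<^bsub>P\<^esub> f = g \<otimes>\<^bsub>P\<^esub> q \<oplus>\<^bsub>P\<^esub> r"
    "r = \<zero>\<^bsub>P\<^esub> \<or> deg R r < deg R g"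
proof -
  obtain q r and k :: nat where *: "q \<in> carrier P" "r \<in> carrier P"
    "(lcoeff g [^] k) \<odot>\<^bsub>P\<^esub> f = g \<otimes>\<^bsub>P\<^esub> q \<oplus>\<^bsub>P\<^esub> r" "r = \<zero>\<^bsub>P\<^esub> \<or> deg R r < deg R g"
    using long_div_theorem[OF assms(2,1,3)] by blast
  have "(lcoeff g [^] k) \<odot>\<^bsub>P\<^esub> f = monom P (lcoeff g) 0 [^]\<^bsub>P\<^esub> k \<otimes>\<^bsub>P\<^esub> f"
    using assms by (simp add: monom_pow monom_mult_is_smult)
  with * show ?thesis using that by simp
qed

context UP_domain
begin

text \<open>The denominators: inverting them turns \<open>P\<close> into the polynomial ring over
  the field of fractions of \<open>R\<close>.\<close>

definition nonzero_consts :: "(nat \<Rightarrow> 'a) set"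
  where "nonzero_consts = {c \<in> carrier P. c \<noteq> \<zero>\<^bsub>P\<^esub> \<and> deg R c = 0}"

text \<open>Divisibility in the polynomial ring over the field of fractions of \<open>R\<close>.\<close>

definition fraction_dvd :: "(nat \<Rightarrow> 'a) \<Rightarrow> (nat \<Rightarrow> 'a) \<Rightarrow> bool"
  where "fraction_dvd g u \<longleftrightarrow> (\<exists>c \<in> nonzero_consts. \<exists>s \<in> carrier P. c \<otimes>\<^bsub>P\<^esub> u = g \<otimes>\<^bsub>P\<^esub> s)"

lemma nonzero_consts_closed: "c \<in> nonzero_consts \<Longrightarrow> c \<in> carrier P"
  and one_nonzero_consts: "\<one>\<^bsub>P\<^esub> \<in> nonzero_consts"
  and lcoeff_nonzero_consts: "f \<in> carrier P \<Longrightarrow> f \<noteq> \<zero>\<^bsub>P\<^esub> \<Longrightarrow> monom P (lcoeff f) 0 \<in> nonzero_consts"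
proof -
  show "monom P (lcoeff f) 0 \<in> nonzero_consts" if f: "f \<in> carrier P" "f \<noteq> \<zero>\<^bsub>P\<^esub>"
  proof -
    have "coeff P (monom P (lcoeff f) 0) 0 \<noteq> \<zero>" using f lcoeff_nonzero2 by simp
    then have "monom P (lcoeff f) 0 \<noteq> \<zero>\<^bsub>P\<^esub>" by force
    then show ?thesis using f by (simp add: nonzero_consts_def)
  qed
qed (auto simp: nonzero_consts_def UP_one_not_zero)

lemma mult_nonzero_consts:
  "c \<in> nonzero_consts \<Longrightarrow> d \<in> nonzero_consts \<Longrightarrow> c \<otimes>\<^bsub>P\<^esub> d \<in> nonzero_consts"
  using UP_integral by (auto simp: nonzero_consts_def)

lemma pow_nonzero_consts: "c \<in> nonzero_consts \<Longrightarrow> c [^]\<^bsub>P\<^esub> (k::nat) \<in> nonzero_consts"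
  by (induction k) (auto simp: one_nonzero_consts mult_nonzero_consts)

lemma deg_nonzero_const_mult:
  "c \<in> nonzero_consts \<Longrightarrow> f \<in> carrier P \<Longrightarrow> f \<noteq> \<zero>\<^bsub>P\<^esub> \<Longrightarrow> deg R (c \<otimes>\<^bsub>P\<^esub> f) = deg R f"
  by (simp add: nonzero_consts_def)

lemma fraction_dvdI:
  "c \<in> nonzero_consts \<Longrightarrow> s \<in> carrier P \<Longrightarrow> c \<otimes>\<^bsub>P\<^esub> u = g \<otimes>\<^bsub>P\<^esub> s \<Longrightarrow> fraction_dvd g u"
  unfolding fraction_dvd_def by blast

text \<open>Nonzero constants are units over the field of fractions.\<close>

lemma fraction_dvd_cancel_const:
  assumes "c \<in> nonzero_consts" "fraction_dvd g (c \<otimes>\<^bsub>P\<^esub> u)" "u \<in> carrier P"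
  shows "fraction_dvd g u"
proof -
  obtain d s where ds: "d \<in> nonzero_consts" "s \<in> carrier P" "d \<otimes>\<^bsub>P\<^esub> (c \<otimes>\<^bsub>P\<^esub> u) = g \<otimes>\<^bsub>P\<^esub> s"
    using assms(2) unfolding fraction_dvd_def by blast
  then have "(d \<otimes>\<^bsub>P\<^esub> c) \<otimes>\<^bsub>P\<^esub> u = g \<otimes>\<^bsub>P\<^esub> s"
    using assms nonzero_consts_closed by (simp add: P.m_assoc)
  with ds assms(1) show ?thesis using mult_nonzero_consts fraction_dvdI by blast
qed

lemma fraction_dvd_mult:
  assumes "fraction_dvd g u" "g \<in> carrier P" "u \<in> carrier P" "v \<in> carrier P"
  shows "fraction_dvd g (v \<otimes>\<^bsub>P\<^esub> u)"
proof -
  obtain d s where ds: "d \<in> nonzero_consts" "s \<in> carrier P" "d \<otimes>\<^bsub>P\<^esub> u = g \<otimes>\<^bsub>P\<^esub> s"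
    using assms(1) unfolding fraction_dvd_def by blast
  note cl = nonzero_consts_closed[OF ds(1)]
  have "d \<otimes>\<^bsub>P\<^esub> (v \<otimes>\<^bsub>P\<^esub> u) = v \<otimes>\<^bsub>P\<^esub> (d \<otimes>\<^bsub>P\<^esub> u)" using cl assms by (simp add: P.m_lcomm)
  also have "\<dots> = g \<otimes>\<^bsub>P\<^esub> (v \<otimes>\<^bsub>P\<^esub> s)" using ds cl assms by (simp add: P.m_lcomm)
  finally show ?thesis by (rule fraction_dvdI[OF ds(1), rotated]) (use ds assms in simp)
qed

lemma fraction_dvd_add:
  assumes "fraction_dvd g u" "fraction_dvd g v" "g \<in> carrier P" "u \<in> carrier P" "v \<in> carrier P"
  shows "fraction_dvd g (u \<oplus>\<^bsub>P\<^esub> v)"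
proof -
  obtain c s where cs: "c \<in> nonzero_consts" "s \<in> carrier P" "c \<otimes>\<^bsub>P\<^esub> u = g \<otimes>\<^bsub>P\<^esub> s"
    using assms(1) unfolding fraction_dvd_def by blast
  obtain d t where dt: "d \<in> nonzero_consts" "t \<in> carrier P" "d \<otimes>\<^bsub>P\<^esub> v = g \<otimes>\<^bsub>P\<^esub> t"
    using assms(2) unfolding fraction_dvd_def by blast
  note cl = nonzero_consts_closed[OF cs(1)] nonzero_consts_closed[OF dt(1)]
  have "(c \<otimes>\<^bsub>P\<^esub> d) \<otimes>\<^bsub>P\<^esub> (u \<oplus>\<^bsub>P\<^esub> v) = d \<otimes>\<^bsub>P\<^esub> (c \<otimes>\<^bsub>P\<^esub> u) \<oplus>\<^bsub>P\<^esub> c \<otimes>\<^bsub>P\<^esub> (d \<otimes>\<^bsub>P\<^esub> v)"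
    using cl assms by (simp add: P.r_distr P.m_ac)
  also have "\<dots> = g \<otimes>\<^bsub>P\<^esub> (d \<otimes>\<^bsub>P\<^esub> s \<oplus>\<^bsub>P\<^esub> c \<otimes>\<^bsub>P\<^esub> t)"
    using cs dt cl assms by (simp add: P.r_distr P.m_lcomm)
  finally show ?thesis
    by (rule fraction_dvdI[OF mult_nonzero_consts[OF cs(1) dt(1)], rotated]) (use cs dt cl in simp)
qed

lemma fraction_dvd_trans:
  assumes "fraction_dvd f g" "fraction_dvd g h" "f \<in> carrier P" "g \<in> carrier P" "h \<in> carrier P"
  shows "fraction_dvd f h"
proof -
  obtain c s where cs: "c \<in> nonzero_consts" "s \<in> carrier P" "c \<otimes>\<^bsub>P\<^esub> h = g \<otimes>\<^bsub>P\<^esub> s"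
    using assms(2) unfolding fraction_dvd_def by blast
  then show ?thesis
    using fraction_dvd_mult[OF assms(1,3,4) cs(2)] fraction_dvd_cancel_const[OF cs(1)] assms
    by (simp add: P.m_comm)
qed

lemma fraction_dvd_self_mult:
  "g \<in> carrier P \<Longrightarrow> s \<in> carrier P \<Longrightarrow> fraction_dvd g (g \<otimes>\<^bsub>P\<^esub> s)"
  using fraction_dvdI[OF one_nonzero_consts] by simp

text \<open>Division with remainder over the field of fractions, with denominators cleared:
  \<open>c\<close> is a power of the leading coefficient of \<open>g\<close>.\<close>

lemma fraction_dvd_pseudo_division:
  assumes "f \<in> carrier P" "g \<in> carrier P" "g \<noteq> \<zero>\<^bsub>P\<^esub>"
  obtains c q r where "c \<in> nonzero_consts" "q \<in> carrier P" "r \<in> carrier P"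
    "c \<otimes>\<^bsub>P\<^esub> f = g \<otimes>\<^bsub>P\<^esub> q \<oplus>\<^bsub>P\<^esub> r" "r = \<zero>\<^bsub>P\<^esub> \<or> deg R r < deg R g"
  using pseudo_division[OF assms] pow_nonzero_consts[OF lcoeff_nonzero_consts[OF assms(2,3)]] by metis

text \<open>The assumption \<open>irred\<close> says that \<open>g\<close> is irreducible over the field of fractions. In the proof,
  a combination \<open>w\<close> of \<open>u\<close> and \<open>g\<close> of minimal degree plays the role of their gcd.\<close>

lemma fraction_dvd_prime:
  assumes g: "g \<in> carrier P" "deg R g > 0"
    and irred: "\<And>w. w \<in> carrier P \<Longrightarrow> deg R w > 0 \<Longrightarrow> fraction_dvd w g \<Longrightarrow> deg R g \<le> deg R w"
    and uv: "u \<in> carrier P" "v \<in> carrier P" "fraction_dvd g (u \<otimes>\<^bsub>P\<^esub> v)"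
  shows "fraction_dvd g u \<or> fraction_dvd g v"
proof (rule disjCI)
  assume nv: "\<not> fraction_dvd g v"
  \<comment> \<open>The ideal of \<open>P\<close> generated by \<open>u\<close> and
    \<open>g\<close>.\<close>
  define W where "W = {\<alpha> \<otimes>\<^bsub>P\<^esub> u \<oplus>\<^bsub>P\<^esub> \<beta> \<otimes>\<^bsub>P\<^esub> g | \<alpha> \<beta>. \<alpha> \<in> carrier P \<and> \<beta> \<in> carrier P}"
  have g0: "g \<noteq> \<zero>\<^bsub>P\<^esub>" using g by auto
  have Wc: "W \<subseteq> carrier P" using g uv by (auto simp: W_def)
  have "g = \<zero>\<^bsub>P\<^esub> \<otimes>\<^bsub>P\<^esub> u \<oplus>\<^bsub>P\<^esub> \<one>\<^bsub>P\<^esub> \<otimes>\<^bsub>P\<^esub> g" using g uv by simp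
  then have gW: "g \<in> W" unfolding W_def by blast
  have "u = \<one>\<^bsub>P\<^esub> \<otimes>\<^bsub>P\<^esub> u \<oplus>\<^bsub>P\<^esub> \<zero>\<^bsub>P\<^esub> \<otimes>\<^bsub>P\<^esub> g" using g uv by simp
  then have uW: "u \<in> W" unfolding W_def by blast
  have Wcomb: "c \<otimes>\<^bsub>P\<^esub> x \<ominus>\<^bsub>P\<^esub> w \<otimes>\<^bsub>P\<^esub> q \<in> W"
    if xw: "x \<in> W" "w \<in> W" and cl: "c \<in> carrier P" "q \<in> carrier P" for x w c q
  proof -
    obtain \<alpha> \<beta> \<gamma> \<delta> where ab: "\<alpha> \<in> carrier P" "\<beta> \<in> carrier P" "\<gamma> \<in> carrier P" "\<delta> \<in> carrier P"
      "x = \<alpha> \<otimes>\<^bsub>P\<^esub> u \<oplus>\<^bsub>P\<^esub> \<beta> \<otimes>\<^bsub>P\<^esub> g" "w = \<gamma> \<otimes>\<^bsub>P\<^esub> u \<oplus>\<^bsub>P\<^esub> \<delta> \<otimes>\<^bsub>P\<^esub> g"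
      using xw unfolding W_def by blast
    have "c \<otimes>\<^bsub>P\<^esub> x \<ominus>\<^bsub>P\<^esub> w \<otimes>\<^bsub>P\<^esub> q
      = (c \<otimes>\<^bsub>P\<^esub> \<alpha> \<ominus>\<^bsub>P\<^esub> \<gamma> \<otimes>\<^bsub>P\<^esub> q) \<otimes>\<^bsub>P\<^esub> u \<oplus>\<^bsub>P\<^esub> (c \<otimes>\<^bsub>P\<^esub> \<beta> \<ominus>\<^bsub>P\<^esub> \<delta> \<otimes>\<^bsub>P\<^esub> q) \<otimes>\<^bsub>P\<^esub> g"
      using ab(1-4) cl g uv unfolding ab(5,6) by algebra
    then show ?thesis unfolding W_def using ab cl by blast
  qed
  obtain w where w: "w \<in> W" "w \<noteq> \<zero>\<^bsub>P\<^esub>"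
    and wmin: "\<And>y. y \<in> W \<Longrightarrow> y \<noteq> \<zero>\<^bsub>P\<^esub> \<Longrightarrow> deg R w \<le> deg R y"
    using ex_has_least_nat[of "\<lambda>w. w \<in> W \<and> w \<noteq> \<zero>\<^bsub>P\<^esub>" g "deg R"] gW g0 by blast
  have wc: "w \<in> carrier P" using w Wc by blast
  \<comment> \<open>The remainder on division by \<open>w\<close> stays in \<open>W\<close>, so
    minimality of \<open>deg R w\<close> makes it zero.\<close>
  have dvd: "\<exists>c \<in> nonzero_consts. \<exists>q \<in> carrier P. c \<otimes>\<^bsub>P\<^esub> x = w \<otimes>\<^bsub>P\<^esub> q" if x: "x \<in> W" for x
  proof -
    have xc: "x \<in> carrier P" using x Wc by blast
    obtain c q r where c: "c \<in> nonzero_consts" "q \<in> carrier P" "r \<in> carrier P"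
      "c \<otimes>\<^bsub>P\<^esub> x = w \<otimes>\<^bsub>P\<^esub> q \<oplus>\<^bsub>P\<^esub> r" "r = \<zero>\<^bsub>P\<^esub> \<or> deg R r < deg R w"
      using fraction_dvd_pseudo_division[OF xc wc w(2)] by metis
    have "c \<otimes>\<^bsub>P\<^esub> x \<ominus>\<^bsub>P\<^esub> w \<otimes>\<^bsub>P\<^esub> q = r" using c(2,3) wc unfolding c(4) by algebra
    then have "r \<in> W" using Wcomb[OF x w(1) nonzero_consts_closed[OF c(1)] c(2)] by simp
    then have "r = \<zero>\<^bsub>P\<^esub>" using wmin c(5) by force
    then show ?thesis using c wc by auto
  qed
  show "fraction_dvd g u"
  proof (cases "deg R w > 0")
    \<comment> \<open>Here \<open>w\<close> divides \<open>g\<close>, and irreducibility makes the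
      cofactor \<open>q\<close> a nonzero constant. So \<open>g\<close> and \<open>w\<close> agree
      up to a unit over the field of fractions, and \<open>w\<close> divides
      \<open>u\<close>.\<close>
    case True
    obtain c q where cq: "c \<in> nonzero_consts" "q \<in> carrier P" "c \<otimes>\<^bsub>P\<^esub> g = w \<otimes>\<^bsub>P\<^esub> q"
      using dvd[OF gW] by blast
    obtain c' q' where cq': "c' \<in> nonzero_consts" "q' \<in> carrier P" "c' \<otimes>\<^bsub>P\<^esub> u = w \<otimes>\<^bsub>P\<^esub> q'"
      using dvd[OF uW] by blast
    note cl = nonzero_consts_closed[OF cq(1)] nonzero_consts_closed[OF cq'(1)]
    have q0: "q \<noteq> \<zero>\<^bsub>P\<^esub>"
      using cq cl g g0 wc UP_integral[of c g] by (auto simp: nonzero_consts_def)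
    have "deg R g = deg R w + deg R q"
      using deg_nonzero_const_mult[OF cq(1) g(1) g0] deg_mult[of w q] cq wc w q0 by simp
    moreover have "deg R g \<le> deg R w" using irred[OF wc True] cq fraction_dvdI by blast
    ultimately have q: "q \<in> nonzero_consts" using q0 cq by (simp add: nonzero_consts_def)
    have "(q \<otimes>\<^bsub>P\<^esub> c') \<otimes>\<^bsub>P\<^esub> u = q \<otimes>\<^bsub>P\<^esub> (w \<otimes>\<^bsub>P\<^esub> q')" using cq cq' cl uv by (simp add: P.m_assoc)
    also have "\<dots> = (w \<otimes>\<^bsub>P\<^esub> q) \<otimes>\<^bsub>P\<^esub> q'" using cq cq' wc by (simp add: P.m_ac)
    also have "\<dots> = g \<otimes>\<^bsub>P\<^esub> (c \<otimes>\<^bsub>P\<^esub> q')" using cq(3)[symmetric] cq' cl g by (simp add: P.m_ac)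
    finally show ?thesis
      by (rule fraction_dvdI[OF mult_nonzero_consts[OF q cq'(1)], rotated]) (use cl cq' in simp)
  next
    \<comment> \<open>Here \<open>w\<close> is a unit over the field of fractions, so
      \<open>w = \<alpha> u + \<beta> g\<close> is a Bezout identity; multiplied by
      \<open>v\<close>, it has only multiples of \<open>g\<close> on the right.\<close>
    case False
    then have wK: "w \<in> nonzero_consts" using w wc by (simp add: nonzero_consts_def)
    obtain \<alpha> \<beta> where ab: "\<alpha> \<in> carrier P" "\<beta> \<in> carrier P" "w = \<alpha> \<otimes>\<^bsub>P\<^esub> u \<oplus>\<^bsub>P\<^esub> \<beta> \<otimes>\<^bsub>P\<^esub> g"
      using w unfolding W_def by blast
    have "w \<otimes>\<^bsub>P\<^esub> v = \<alpha> \<otimes>\<^bsub>P\<^esub> (u \<otimes>\<^bsub>P\<^esub> v) \<oplus>\<^bsub>P\<^esub> g \<otimes>\<^bsub>P\<^esub> (\<beta> \<otimes>\<^bsub>P\<^esub> v)"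
      using ab(1,2) g uv unfolding ab(3) by algebra
    moreover have "fraction_dvd g (\<alpha> \<otimes>\<^bsub>P\<^esub> (u \<otimes>\<^bsub>P\<^esub> v))" "fraction_dvd g (g \<otimes>\<^bsub>P\<^esub> (\<beta> \<otimes>\<^bsub>P\<^esub> v))"
      using ab uv g by (simp_all add: fraction_dvd_mult fraction_dvd_self_mult)
    ultimately have "fraction_dvd g (w \<otimes>\<^bsub>P\<^esub> v)"
      using fraction_dvd_add ab uv g by simp
    then have "fraction_dvd g v" using fraction_dvd_cancel_const[OF wK] uv by blast
    with nv show ?thesis by blast
  qed
qed

text \<open>The set is the contraction to \<open>P\<close> of the ideal generated by
  \<open>g\<close> over the field of fractions, prime by \<open>fraction_dvd_prime\<close>. It
  avoids nonzero constants because a nonzero multiple of \<open>g\<close> has positive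
  degree.\<close>

lemma primeideal_fraction_multiples:
  assumes g: "g \<in> carrier P" "deg R g > 0"
    and irred: "\<And>w. w \<in> carrier P \<Longrightarrow> deg R w > 0 \<Longrightarrow> fraction_dvd w g \<Longrightarrow> deg R g \<le> deg R w"
  shows "primeideal {u \<in> carrier P. fraction_dvd g u} P" (is "primeideal ?Q P")
    and "{u \<in> carrier P. fraction_dvd g u} \<inter> nonzero_consts = {}"
proof -
  have g0: "g \<noteq> \<zero>\<^bsub>P\<^esub>" using g by auto
  have no: "\<not> fraction_dvd g c" if c: "c \<in> nonzero_consts" for c
  proof
    assume "fraction_dvd g c"
    then obtain d s where ds: "d \<in> nonzero_consts" "s \<in> carrier P" "d \<otimes>\<^bsub>P\<^esub> c = g \<otimes>\<^bsub>P\<^esub> s"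
      unfolding fraction_dvd_def by blast
    then have K: "g \<otimes>\<^bsub>P\<^esub> s \<in> nonzero_consts" using mult_nonzero_consts[OF ds(1) c] by simp
    then have "s \<noteq> \<zero>\<^bsub>P\<^esub>" using g by (auto simp: nonzero_consts_def)
    then show False using K g g0 ds by (simp add: nonzero_consts_def)
  qed
  then show "?Q \<inter> nonzero_consts = {}" by blast
  have mul: "x \<otimes>\<^bsub>P\<^esub> a \<in> ?Q" if "a \<in> ?Q" "x \<in> carrier P" for a x
    using that g fraction_dvd_mult by simp
  show "primeideal ?Q P"
  proof (rule primeidealI)
    show "ideal ?Q P"
    proof (rule idealI)
      show "subgroup ?Q (add_monoid P)"
      proof (rule P.add.subgroupI)
        show "?Q \<noteq> {}" using g fraction_dvd_self_mult[of g "\<one>\<^bsub>P\<^esub>"] by auto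
        show "\<ominus>\<^bsub>P\<^esub> a \<in> ?Q" if "a \<in> ?Q" for a
          using mul[OF that, of "\<ominus>\<^bsub>P\<^esub> \<one>\<^bsub>P\<^esub>"] that by (simp add: P.l_minus)
        show "a \<oplus>\<^bsub>P\<^esub> b \<in> ?Q" if "a \<in> ?Q" "b \<in> ?Q" for a b
          using that g fraction_dvd_add by simp
      qed auto
      show "a \<otimes>\<^bsub>P\<^esub> x \<in> ?Q" if "a \<in> ?Q" "x \<in> carrier P" for a x
        using mul[OF that] that by (simp add: P.m_comm)
    qed (use mul P.ring_axioms in auto)
    show "carrier P \<noteq> ?Q" using no one_nonzero_consts nonzero_consts_closed by blast
    show "a \<in> ?Q \<or> b \<in> ?Q" if "a \<in> carrier P" "b \<in> carrier P" "a \<otimes>\<^bsub>P\<^esub> b \<in> ?Q" for a b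
      using fraction_dvd_prime[OF g irred] that by blast
  qed (rule P.cring_axioms)
qed

text \<open>The primes are the contractions of the irreducible factors of \<open>f\<close> over the field of fractions.
  Quantifying over multiplicatively closed sets \<open>T\<close> instead of products of one element from each
  \<open>Q\<close> takes care of multiplicities.\<close>

lemma primes_over_polynomial:
  assumes "f \<in> carrier P" "f \<noteq> \<zero>\<^bsub>P\<^esub>"
  shows "\<exists>F. finite F \<and> (\<forall>Q \<in> F. primeideal Q P \<and> f \<in> Q \<and> Q \<inter> nonzero_consts = {}) \<and>
    (\<forall>T. T \<subseteq> carrier P \<and> \<one>\<^bsub>P\<^esub> \<in> T \<and> (\<forall>x \<in> T. \<forall>y \<in> T. x \<otimes>\<^bsub>P\<^esub> y \<in> T) \<and> (\<forall>Q \<in> F. T \<inter> Q \<noteq> {}) \<longrightarrow>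
      (\<exists>h \<in> T. fraction_dvd f h))"
  using assms
proof (induction "deg R f" arbitrary: f rule: less_induct)
  case less
  show ?case
  proof (cases "deg R f = 0")
    \<comment> \<open>A nonzero constant is a unit over the field of fractions: with no primes at
      all, \<open>h\<close> can be taken as the unit element of \<open>T\<close>.\<close>
    case True
    then have "f \<in> nonzero_consts" using less.prems by (simp add: nonzero_consts_def)
    then have "fraction_dvd f \<one>\<^bsub>P\<^esub>"
      using less.prems by (intro fraction_dvdI[of f "\<one>\<^bsub>P\<^esub>"]) simp_all
    then show ?thesis by (intro exI[of _ "{}"]) auto
  next
    case False
    have refl: "fraction_dvd g g" if "g \<in> carrier P" for g
      using fraction_dvd_self_mult[of g "\<one>\<^bsub>P\<^esub>"] that by simp
    obtain g where g: "g \<in> carrier P" "deg R g > 0" "fraction_dvd g f"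
      and gmin: "\<And>w. w \<in> carrier P \<Longrightarrow> deg R w > 0 \<Longrightarrow> fraction_dvd w f \<Longrightarrow> deg R g \<le> deg R w"
      using ex_has_least_nat[of "\<lambda>w. w \<in> carrier P \<and> deg R w > 0 \<and> fraction_dvd w f" f "deg R"]
        less.prems False refl by blast
    \<comment> \<open>A nonconstant divisor of \<open>f\<close> of least degree is irreducible,
      since its divisors divide \<open>f\<close> too.\<close>
    then have irred: "\<And>w. w \<in> carrier P \<Longrightarrow> deg R w > 0 \<Longrightarrow> fraction_dvd w g \<Longrightarrow> deg R g \<le> deg R w"
      using fraction_dvd_trans less.prems by blast
    note prime = primeideal_fraction_multiples[OF g(1,2) irred]
    have g0: "g \<noteq> \<zero>\<^bsub>P\<^esub>" using g by auto
    obtain c h where ch: "c \<in> nonzero_consts" "h \<in> carrier P" "c \<otimes>\<^bsub>P\<^esub> f = g \<otimes>\<^bsub>P\<^esub> h"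
      using g(3) unfolding fraction_dvd_def by blast
    note cl = nonzero_consts_closed[OF ch(1)]
    have h0: "h \<noteq> \<zero>\<^bsub>P\<^esub>"
      using ch g less.prems UP_integral[of c f] by (auto simp: nonzero_consts_def)
    have "deg R f = deg R g + deg R h"
      using deg_nonzero_const_mult[OF ch(1) less.prems] deg_mult[of g h] ch g g0 h0 by simp
    then have "deg R h < deg R f" using g by simp
    from less.hyps[OF this ch(2) h0] obtain F where F: "finite F"
      "\<And>Q. Q \<in> F \<Longrightarrow> primeideal Q P \<and> h \<in> Q \<and> Q \<inter> nonzero_consts = {}"
      "\<And>T. T \<subseteq> carrier P \<Longrightarrow> \<one>\<^bsub>P\<^esub> \<in> T \<Longrightarrow> (\<forall>x \<in> T. \<forall>y \<in> T. x \<otimes>\<^bsub>P\<^esub> y \<in> T) \<Longrightarrow>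
        (\<forall>Q \<in> F. T \<inter> Q \<noteq> {}) \<Longrightarrow> (\<exists>h' \<in> T. fraction_dvd h h')"
      by metis
    \<comment> \<open>This is where avoiding nonzero constants is used: \<open>Q\<close> contains
      \<open>g h\<close>, which equals \<open>c f\<close>, but not \<open>c\<close>.\<close>
    have fQ: "f \<in> Q" if Q: "Q \<in> F" for Q
    proof -
      interpret Q: primeideal Q P using F(2)[OF Q] by blast
      have "c \<otimes>\<^bsub>P\<^esub> f \<in> Q" unfolding ch(3) using F(2)[OF Q] g by (simp add: Q.I_l_closed)
      then show ?thesis using Q.I_prime[OF cl less.prems(1)] F(2)[OF Q] ch by blast
    qed
    let ?Q = "{u \<in> carrier P. fraction_dvd g u}"
    have "\<exists>h \<in> T. fraction_dvd f h" if T: "T \<subseteq> carrier P" "\<one>\<^bsub>P\<^esub> \<in> T" "\<forall>x \<in> T. \<forall>y \<in> T. x \<otimes>\<^bsub>P\<^esub> y \<in> T"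
      "\<forall>Q \<in> insert ?Q F. T \<inter> Q \<noteq> {}" for T
    proof -
      \<comment> \<open>The product of a multiple \<open>t\<close> of \<open>g\<close> and a
        multiple \<open>h'\<close> of \<open>h\<close>, both in \<open>T\<close>, is a multiple of
        \<open>g h\<close> and hence of \<open>f\<close>.\<close>
      have "T \<inter> ?Q \<noteq> {}" and TF: "\<forall>Q \<in> F. T \<inter> Q \<noteq> {}" using T(4) by simp_all
      then obtain t where t: "t \<in> T" "fraction_dvd g t" by blast
      obtain h' where h': "h' \<in> T" "fraction_dvd h h'" using F(3)[OF T(1-3) TF] by blast
      obtain d s where ds: "d \<in> nonzero_consts" "s \<in> carrier P" "d \<otimes>\<^bsub>P\<^esub> t = g \<otimes>\<^bsub>P\<^esub> s"
        using t unfolding fraction_dvd_def by blast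
      obtain d' s' where ds': "d' \<in> nonzero_consts" "s' \<in> carrier P" "d' \<otimes>\<^bsub>P\<^esub> h' = h \<otimes>\<^bsub>P\<^esub> s'"
        using h' unfolding fraction_dvd_def by blast
      note cl' = cl nonzero_consts_closed[OF ds(1)] nonzero_consts_closed[OF ds'(1)] subsetD[OF T(1) t(1)] subsetD[OF T(1) h'(1)]
      have "(d \<otimes>\<^bsub>P\<^esub> d') \<otimes>\<^bsub>P\<^esub> (t \<otimes>\<^bsub>P\<^esub> h') = (d \<otimes>\<^bsub>P\<^esub> t) \<otimes>\<^bsub>P\<^esub> (d' \<otimes>\<^bsub>P\<^esub> h')"
        using cl' by (simp add: P.m_ac)
      also have "\<dots> = (g \<otimes>\<^bsub>P\<^esub> h) \<otimes>\<^bsub>P\<^esub> (s \<otimes>\<^bsub>P\<^esub> s')"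
        unfolding ds ds' using ds ds' ch g by (simp add: P.m_ac)
      also have "\<dots> = f \<otimes>\<^bsub>P\<^esub> (c \<otimes>\<^bsub>P\<^esub> (s \<otimes>\<^bsub>P\<^esub> s'))"
        unfolding ch(3)[symmetric] using ds ds' cl' less.prems by (simp add: P.m_ac)
      finally have "fraction_dvd f (t \<otimes>\<^bsub>P\<^esub> h')"
        by (rule fraction_dvdI[OF mult_nonzero_consts[OF ds(1) ds'(1)], rotated]) (use ds ds' cl' in simp)
      then show ?thesis using T(3) t(1) h'(1) by blast
    qed
    note dvd = this
    have pr: "primeideal Q P \<and> f \<in> Q \<and> Q \<inter> nonzero_consts = {}" if "Q \<in> insert ?Q F" for Q
    proof (cases "Q = ?Q")
      case True
      then show ?thesis using prime g(3) less.prems(1) by simp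
    qed (use that fQ F(2) in blast)
    show ?thesis
    proof (intro exI[of _ "insert ?Q F"] conjI[OF _ conjI] ballI allI impI)
      show "\<exists>h \<in> T. fraction_dvd f h"
        if "T \<subseteq> carrier P \<and> \<one>\<^bsub>P\<^esub> \<in> T \<and> (\<forall>x \<in> T. \<forall>y \<in> T. x \<otimes>\<^bsub>P\<^esub> y \<in> T) \<and> (\<forall>Q \<in> insert ?Q F. T \<inter> Q \<noteq> {})" for T
        using that by (elim conjE) (rule dvd)
    qed (use F(1) pr in \<open>simp_all only: finite_insert\<close>)
  qed
qed

text \<open>Over the localization of \<open>R\<close> at the leading coefficient, \<open>f\<close> is monic up to a unit, so that
  remainders modulo \<open>f\<close> are unique and no further denominators are needed.\<close>

lemma fraction_dvd_lcoeff_pow: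
  assumes f: "f \<in> carrier P" "f \<noteq> \<zero>\<^bsub>P\<^esub>" and h: "h \<in> carrier P" "fraction_dvd f h"
  shows "\<exists>k::nat. \<exists>q \<in> carrier P. monom P (lcoeff f) 0 [^]\<^bsub>P\<^esub> k \<otimes>\<^bsub>P\<^esub> h = f \<otimes>\<^bsub>P\<^esub> q"
proof -
  obtain c s where cs: "c \<in> nonzero_consts" "s \<in> carrier P" "c \<otimes>\<^bsub>P\<^esub> h = f \<otimes>\<^bsub>P\<^esub> s"
    using h unfolding fraction_dvd_def by blast
  note cl = nonzero_consts_closed[OF cs(1)]
  obtain q r and k :: nat where d: "q \<in> carrier P" "r \<in> carrier P"
    "monom P (lcoeff f) 0 [^]\<^bsub>P\<^esub> k \<otimes>\<^bsub>P\<^esub> h = f \<otimes>\<^bsub>P\<^esub> q \<oplus>\<^bsub>P\<^esub> r" "r = \<zero>\<^bsub>P\<^esub> \<or> deg R r < deg R f"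
    using pseudo_division[OF h(1) f] by metis
  define a where "a = monom P (lcoeff f) 0 [^]\<^bsub>P\<^esub> k"
  have ac: "a \<in> carrier P" using f unfolding a_def by (intro P.nat_pow_closed) simp
  have "c \<otimes>\<^bsub>P\<^esub> (a \<otimes>\<^bsub>P\<^esub> h) = a \<otimes>\<^bsub>P\<^esub> (f \<otimes>\<^bsub>P\<^esub> s)" using ac cl h cs(3)[symmetric] by (simp add: P.m_lcomm)
  then have e: "c \<otimes>\<^bsub>P\<^esub> (f \<otimes>\<^bsub>P\<^esub> q \<oplus>\<^bsub>P\<^esub> r) = a \<otimes>\<^bsub>P\<^esub> (f \<otimes>\<^bsub>P\<^esub> s)" using d(3) a_def by simp
  have "c \<otimes>\<^bsub>P\<^esub> r = c \<otimes>\<^bsub>P\<^esub> (f \<otimes>\<^bsub>P\<^esub> q \<oplus>\<^bsub>P\<^esub> r) \<ominus>\<^bsub>P\<^esub> f \<otimes>\<^bsub>P\<^esub> (c \<otimes>\<^bsub>P\<^esub> q)"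
    using cl d(1,2) f by algebra
  also have "\<dots> = f \<otimes>\<^bsub>P\<^esub> (a \<otimes>\<^bsub>P\<^esub> s \<ominus>\<^bsub>P\<^esub> c \<otimes>\<^bsub>P\<^esub> q)"
    unfolding e using ac cs(2) cl d(1,2) f(1) by algebra
  finally have cr: "c \<otimes>\<^bsub>P\<^esub> r = f \<otimes>\<^bsub>P\<^esub> (a \<otimes>\<^bsub>P\<^esub> s \<ominus>\<^bsub>P\<^esub> c \<otimes>\<^bsub>P\<^esub> q)" (is "_ = f \<otimes>\<^bsub>P\<^esub> ?z") .
  \<comment> \<open>Otherwise the left side of \<open>cr\<close> has degree \<open>deg R r\<close>,
    below \<open>deg R f\<close>, while the right side has degree at least
    \<open>deg R f\<close>.\<close>
  have "r = \<zero>\<^bsub>P\<^esub>"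
  proof (rule ccontr)
    assume r0: "r \<noteq> \<zero>\<^bsub>P\<^esub>"
    have zc: "?z \<in> carrier P" using ac cs cl d by simp
    have z0: "?z \<noteq> \<zero>\<^bsub>P\<^esub>"
    proof
      assume "?z = \<zero>\<^bsub>P\<^esub>"
      then have "c \<otimes>\<^bsub>P\<^esub> r = \<zero>\<^bsub>P\<^esub>" using cr f by simp
      then show False using r0 d cl cs UP_integral[of c r] by (auto simp: nonzero_consts_def)
    qed
    have "deg R (c \<otimes>\<^bsub>P\<^esub> r) = deg R r" using cs d r0 by (simp add: deg_nonzero_const_mult)
    moreover have "deg R (f \<otimes>\<^bsub>P\<^esub> ?z) = deg R f + deg R ?z" using f zc z0 by (intro deg_mult)
    ultimately show False using cr d(4) r0 by simp
  qed
  then show ?thesis using d f by auto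
qed

end

section \<open>Contraction and reduction of primes\<close>

lemma (in ring_hom_cring) primeideal_vimage:
  assumes "primeideal Q S"
  shows "primeideal {a \<in> carrier R. h a \<in> Q} R"
proof (rule primeidealI)
  interpret Q: primeideal Q S by fact
  show "ideal {a \<in> carrier R. h a \<in> Q} R" by (rule ring.ideal_vimage) (rule Q.ideal_axioms)
  show "carrier R \<noteq> {a \<in> carrier R. h a \<in> Q}"
  proof -
    have "\<one> \<notin> {a \<in> carrier R. h a \<in> Q}" using primeideal_one_notin[OF assms] by simp
    then show ?thesis using R.one_closed by metis
  qed
  show "a \<in> {a \<in> carrier R. h a \<in> Q} \<or> b \<in> {a \<in> carrier R. h a \<in> Q}"
    if "a \<in> carrier R" "b \<in> carrier R" "a \<otimes> b \<in> {a \<in> carrier R. h a \<in> Q}" for a b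
    using that Q.I_prime by simp
qed (rule R.cring_axioms)

text \<open>For a prime \<open>P\<close> over \<open>S\<close>, the preimage of \<open>P\<close>
  under \<open>\<psi>\<close> is a prime over the image of \<open>S\<close>. A member
  \<open>Q\<close> of \<open>F\<close> below it contracts along \<open>\<phi>\<close> into
  \<open>P\<close>, because \<open>\<psi>\<close> undoes \<open>\<phi>\<close>.\<close>

lemma finite_min_primes_retract:
  assumes "ring_hom_cring A B \<phi>" "ring_hom_cring B A \<psi>" "\<And>a. a \<in> carrier A \<Longrightarrow> \<psi> (\<phi> a) = a"
    and S: "S \<subseteq> carrier A" "finite_min_primes B (\<phi> ` S)"
  shows "finite_min_primes A S"
proof -
  interpret \<phi>: ring_hom_cring A B \<phi> by fact
  interpret \<psi>: ring_hom_cring B A \<psi> by fact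
  define con where "con Q = {a \<in> carrier A. \<phi> a \<in> Q}" for Q
  obtain F where F: "finite F" "F \<subseteq> zero_locus B (\<phi> ` S)"
    "\<And>P. P \<in> zero_locus B (\<phi> ` S) \<Longrightarrow> \<exists>Q \<in> F. Q \<subseteq> P"
    using S(2) unfolding finite_min_primes_def by metis
  have "\<exists>Q \<in> F. con Q \<subseteq> P" if P: "P \<in> zero_locus A S" for P
  proof -
    have "{b \<in> carrier B. \<psi> b \<in> P} \<in> zero_locus B (\<phi> ` S)"
      using P S(1) assms(3) \<psi>.primeideal_vimage by (auto simp: zero_locus_iff subset_iff)
    then obtain Q where Q: "Q \<in> F" "Q \<subseteq> {b \<in> carrier B. \<psi> b \<in> P}" using F(3) by blast
    then have "con Q \<subseteq> P" using assms(3) by (auto simp: con_def subset_iff)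
    with Q(1) show ?thesis by blast
  qed
  moreover have "con Q \<in> zero_locus A S" if "Q \<in> F" for Q
    using that F(2) S(1) \<phi>.primeideal_vimage by (auto simp: zero_locus_iff con_def subset_iff)
  ultimately show ?thesis
    unfolding finite_min_primes_def using F(1) by (intro exI[of _ "con ` F"]) auto
qed

text \<open>Divides the zero locus of \<open>S\<close> into the closed part where \<open>a\<close>
  vanishes and its open complement; \<open>F\<close> has to supply lower bounds only for the
  latter.\<close>

lemma finite_min_primes_split:
  assumes "finite_min_primes A (insert a S)"
    and "finite F" "F \<subseteq> zero_locus A S" "\<And>P. P \<in> zero_locus A S \<Longrightarrow> a \<notin> P \<Longrightarrow> \<exists>Q \<in> F. Q \<subseteq> P"
  shows "finite_min_primes A S"
proof -
  obtain G where G: "finite G" "G \<subseteq> zero_locus A (insert a S)"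
    "\<And>P. P \<in> zero_locus A (insert a S) \<Longrightarrow> \<exists>Q \<in> G. Q \<subseteq> P"
    using assms(1) unfolding finite_min_primes_def by metis
  have "\<exists>Q \<in> F \<union> G. Q \<subseteq> P" if P: "P \<in> zero_locus A S" for P
  proof (cases "a \<in> P")
    case True
    then have "P \<in> zero_locus A (insert a S)" using P by (simp add: zero_locus_iff)
    then show ?thesis using G(3) by blast
  qed (use assms(4)[OF P] in blast)
  moreover have "F \<union> G \<subseteq> zero_locus A S" using assms(3) G(2) by (auto simp: zero_locus_iff)
  ultimately show ?thesis
    unfolding finite_min_primes_def using assms(2) G(1) by (intro exI[of _ "F \<union> G"]) simp
qed

text \<open>Polynomials are coefficient functions, so composition with \<open>h\<close> acts
  coefficientwise. Degree bounds survive because \<open>h\<close> preserves zero.\<close>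

lemma (in ring_hom_cring) UP_map_hom: "ring_hom_cring (UP R) (UP S) (\<lambda>f. h \<circ> f)"
proof -
  interpret UPR: UP_cring R "UP R" by (simp add: UP_cring_def R.cring_axioms)
  interpret UPS: UP_cring S "UP S" by (simp add: UP_cring_def S.cring_axioms)
  have cl: "h \<circ> f \<in> up S" if f: "f \<in> up R" for f
  proof -
    obtain n where "bound \<zero> n f" using R.bound_upD[OF f] by blast
    then have "bound \<zero>\<^bsub>S\<^esub> n (h \<circ> f)" by (auto simp: bound_def)
    then show ?thesis using mem_upD[OF f] by (intro mem_upI) auto
  qed
  have "(\<lambda>f. h \<circ> f) \<in> ring_hom (UP R) (UP S)"
  proof (rule ring_hom_memI)
    fix f g assume fg: "f \<in> carrier (UP R)" "g \<in> carrier (UP R)"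
    then have up: "f \<in> up R" "g \<in> up R" by (simp_all add: UP_def)
    show "h \<circ> (f \<oplus>\<^bsub>UP R\<^esub> g) = (h \<circ> f) \<oplus>\<^bsub>UP S\<^esub> (h \<circ> g)"
      using up cl by (auto simp: UP_def fun_eq_iff mem_upD)
    show "h \<circ> (f \<otimes>\<^bsub>UP R\<^esub> g) = (h \<circ> f) \<otimes>\<^bsub>UP S\<^esub> (h \<circ> g)"
    proof
      fix n
      have "h (\<Oplus>i\<in>{..n}. f i \<otimes> g (n - i)) = (\<Oplus>\<^bsub>S\<^esub>i\<in>{..n}. h (f i) \<otimes>\<^bsub>S\<^esub> h (g (n - i)))"
        using up by (subst hom_finsum) (auto simp: mem_upD o_def intro!: S.finsum_cong')
      then show "(h \<circ> (f \<otimes>\<^bsub>UP R\<^esub> g)) n = ((h \<circ> f) \<otimes>\<^bsub>UP S\<^esub> (h \<circ> g)) n"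
        using up cl by (simp add: UP_def)
    qed
  qed (use cl in \<open>auto simp: UP_def\<close>)
  then show ?thesis
    by (rule ring_hom_cringI[OF UPR.P.cring_axioms UPS.P.cring_axioms])
qed

section \<open>Constants, evaluation at zero and extended ideals\<close>

context UP_cring
begin

text \<open>For an ideal \<open>p\<close>, this is its extension to the polynomial ring.\<close>

definition polys_over :: "'a set \<Rightarrow> (nat \<Rightarrow> 'a) set"
  where "polys_over p = {f \<in> carrier P. \<forall>n. coeff P f n \<in> p}"

lemma const_ring_hom_cring: "ring_hom_cring R P (\<lambda>a. monom P a 0)"
  using const_ring_hom R.cring_axioms P.cring_axioms
  by (simp add: ring_hom_cring_def ring_hom_cring_axioms_def)

lemma coeff_0_ring_hom_cring: "ring_hom_cring P R (\<lambda>f. coeff P f 0)"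
  using R.cring_axioms P.cring_axioms
  by (auto simp: ring_hom_cring_def ring_hom_cring_axioms_def intro!: ring_hom_memI)

lemma monom_eq_const_mult: "a \<in> carrier R \<Longrightarrow> monom P a n = monom P a 0 \<otimes>\<^bsub>P\<^esub> monom P \<one> n"
  using monom_mult[of a \<one> 0 n] by simp

text \<open>A polynomial is the sum of its monomials, each a constant from \<open>p\<close> times a
  power of the indeterminate.\<close>

lemma polys_over_subset:
  assumes "primeideal Q P" "\<And>a. a \<in> p \<Longrightarrow> a \<in> carrier R \<Longrightarrow> monom P a 0 \<in> Q"
  shows "polys_over p \<subseteq> Q"
proof
  interpret Q: primeideal Q P by fact
  fix f assume f: "f \<in> polys_over p"
  then have fc: "f \<in> carrier P" by (simp add: polys_over_def)
  have mon: "monom P (coeff P f n) n \<in> Q" for n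
    using f fc assms(2) monom_eq_const_mult[of "coeff P f n" n] Q.I_r_closed
    by (simp add: polys_over_def)
  have "(\<Oplus>\<^bsub>P\<^esub> i \<in> {..n::nat}. monom P (coeff P f i) i) \<in> Q" for n
    using fc mon by (induction n) (simp_all add: Pi_def)
  then show "f \<in> Q" using up_repr[OF fc] by metis
qed

end

section \<open>Reduction of coefficients modulo a prime\<close>

locale UP_prime_quotient = UP_cring + p: primeideal p R for p
begin

definition red :: "(nat \<Rightarrow> 'a) \<Rightarrow> nat \<Rightarrow> 'a set"
  where "red f = (+>) p \<circ> f"

sublocale D: UP_domain "R Quot p" "UP (R Quot p)"
  using p.quotient_is_domain by (simp add: UP_domain_def)

sublocale red: ring_hom_cring P "UP (R Quot p)" red
  unfolding red_def using ring_hom_cring.UP_map_hom[OF p.rcos_ring_hom_cring] P_def by simp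

lemma coset_eq_zero_iff: "a \<in> carrier R \<Longrightarrow> p +> a = \<zero>\<^bsub>R Quot p\<^esub> \<longleftrightarrow> a \<in> p"
  using p.a_rcos_const p.a_rcos_self by (auto simp: FactRing_def)

lemma coeff_red: "f \<in> carrier P \<Longrightarrow> coeff (UP (R Quot p)) (red f) n = p +> coeff P f n"
  using red.hom_closed[of f] by (simp add: UP_def P_def red_def)

lemma red_eq_zero_iff: "f \<in> carrier P \<Longrightarrow> red f = \<zero>\<^bsub>UP (R Quot p)\<^esub> \<longleftrightarrow> f \<in> polys_over p"
proof -
  assume f: "f \<in> carrier P"
  have "red f = \<zero>\<^bsub>UP (R Quot p)\<^esub> \<longleftrightarrow> (\<forall>n. coeff (UP (R Quot p)) (red f) n = \<zero>\<^bsub>R Quot p\<^esub>)"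
    using f D.up_eqI[of "red f" "\<zero>\<^bsub>UP (R Quot p)\<^esub>"] by auto
  also have "\<dots> \<longleftrightarrow> f \<in> polys_over p"
    using f by (simp add: coeff_red coset_eq_zero_iff polys_over_def)
  finally show ?thesis .
qed

lemma red_monom: "a \<in> carrier R \<Longrightarrow> red (monom P a n) = monom (UP (R Quot p)) (p +> a) n"
proof (rule D.up_eqI)
  assume a: "a \<in> carrier R"
  then have a': "p +> a \<in> carrier (R Quot p)" by (rule ring_hom_closed[OF p.rcos_ring_hom])
  have "p +> \<zero> = \<zero>\<^bsub>R Quot p\<^esub>" using coset_eq_zero_iff[of \<zero>] by simp
  then show "coeff (UP (R Quot p)) (red (monom P a n)) k = coeff (UP (R Quot p)) (monom (UP (R Quot p)) (p +> a) n) k" for k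
    using a a' by (simp add: coeff_red)
  show "red (monom P a n) \<in> carrier (UP (R Quot p))" "monom (UP (R Quot p)) (p +> a) n \<in> carrier (UP (R Quot p))"
    using a a' by simp_all
qed

lemma red_surj:
  assumes "g \<in> carrier (UP (R Quot p))"
  obtains f where "f \<in> carrier P" "red f = g"
proof -
  have g: "g \<in> up (R Quot p)" using assms by (simp add: UP_def)
  \<comment> \<open>The zero coset is lifted to \<open>\<zero>\<close> itself; otherwise the lifted
    coefficient function might have infinite support.\<close>
  have ex: "\<exists>a \<in> carrier R. p +> a = g n \<and> (g n = \<zero>\<^bsub>R Quot p\<^esub> \<longrightarrow> a = \<zero>)" for n
  proof (cases "g n = \<zero>\<^bsub>R Quot p\<^esub>")
    case True
    then show ?thesis using coset_eq_zero_iff[of \<zero>] by auto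
  next
    case False
    have "g n \<in> carrier (R Quot p)" using g by auto
    then obtain a where "a \<in> carrier R" "g n = p +> a" by (auto simp: FactRing_def A_RCOSETS_def')
    with False show ?thesis by auto
  qed
  then obtain f where f: "\<And>n. f n \<in> carrier R" "\<And>n. p +> f n = g n" "\<And>n. g n = \<zero>\<^bsub>R Quot p\<^esub> \<Longrightarrow> f n = \<zero>"
    by metis
  obtain m where "bound \<zero>\<^bsub>R Quot p\<^esub> m g" using D.R.bound_upD[OF g] by blast
  then have "bound \<zero> m f" using f(3) by (auto simp: bound_def)
  then have "f \<in> carrier P" using f(1) by (auto simp: P_def UP_def up_def)
  moreover have "red f = g" using f(2) by (auto simp: red_def)
  ultimately show ?thesis by (rule that)
qed

text \<open>It is the kernel of \<open>red\<close>, whose target is a domain.\<close>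

lemma primeideal_polys_over: "primeideal (polys_over p) P"
proof -
  have "polys_over p = {f \<in> carrier P. red f \<in> {\<zero>\<^bsub>UP (R Quot p)\<^esub>}}"
    using red_eq_zero_iff by (auto simp: polys_over_def)
  then show ?thesis using red.primeideal_vimage[OF D.zeroprimeideal] by simp
qed

text \<open>The primes are the contractions along \<open>red\<close> of those that
  \<open>primes_over_polynomial\<close> attaches to \<open>red f\<close>.\<close>

lemma primes_over_lcoeff_notin:
  assumes f: "f \<in> carrier P" "lcoeff f \<notin> p"
  shows "\<exists>F. finite F \<and> (\<forall>Q \<in> F. primeideal Q P \<and> f \<in> Q \<and> polys_over p \<subseteq> Q) \<and>
    (\<forall>Q. primeideal Q P \<and> f \<in> Q \<and> polys_over p \<subseteq> Q \<and> monom P (lcoeff f) 0 \<notin> Q \<longrightarrow> (\<exists>Q' \<in> F. Q' \<subseteq> Q))"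
proof -
  let ?D = "UP (R Quot p)"
  have rc: "red f \<in> carrier ?D" using f by simp
  \<comment> \<open>The leading coefficient of \<open>f\<close> survives reduction, so
    \<open>red f\<close> keeps its degree and its leading coefficient is the class of
    \<open>lcoeff f\<close>.\<close>
  have lc: "coeff ?D (red f) (deg R f) \<noteq> \<zero>\<^bsub>R Quot p\<^esub>"
    using f by (simp add: coeff_red coset_eq_zero_iff)
  have deg: "deg (R Quot p) (red f) = deg R f"
  proof (rule antisym)
    show "deg (R Quot p) (red f) \<le> deg R f"
      by (rule D.deg_aboveI[OF _ rc]) (use f deg_aboveD coset_eq_zero_iff[of \<zero>] in \<open>simp add: coeff_red\<close>)
    show "deg R f \<le> deg (R Quot p) (red f)" by (rule D.deg_belowI[OF _ rc]) (rule lc)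
  qed
  have r0: "red f \<noteq> \<zero>\<^bsub>?D\<^esub>" using lc by auto
  obtain F where F: "finite F" "\<And>Q. Q \<in> F \<Longrightarrow> primeideal Q ?D \<and> red f \<in> Q"
      "\<And>T. T \<subseteq> carrier ?D \<Longrightarrow> \<one>\<^bsub>?D\<^esub> \<in> T \<Longrightarrow> (\<forall>x \<in> T. \<forall>y \<in> T. x \<otimes>\<^bsub>?D\<^esub> y \<in> T) \<Longrightarrow>
        (\<forall>Q \<in> F. T \<inter> Q \<noteq> {}) \<Longrightarrow> (\<exists>h \<in> T. D.fraction_dvd (red f) h)"
    using D.primes_over_polynomial[OF rc r0] by metis
  define con where "con Q = {g \<in> carrier P. red g \<in> Q}" for Q
  have con: "primeideal (con Q) P \<and> f \<in> con Q \<and> polys_over p \<subseteq> con Q" if Q: "Q \<in> F" for Q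
  proof -
    interpret Q: primeideal Q ?D using F(2)[OF Q] by blast
    have "polys_over p \<subseteq> con Q"
    proof
      fix g assume g: "g \<in> polys_over p"
      then have gc: "g \<in> carrier P" by (simp add: polys_over_def)
      then show "g \<in> con Q" using g red_eq_zero_iff[OF gc] Q.zero_closed by (simp add: con_def)
    qed
    then show ?thesis using F(2)[OF Q] f red.primeideal_vimage by (simp add: con_def)
  qed
  have "\<exists>Q' \<in> F. con Q' \<subseteq> Q"
    if Q: "primeideal Q P" "f \<in> Q" "polys_over p \<subseteq> Q" "monom P (lcoeff f) 0 \<notin> Q" for Q
  proof (rule ccontr)
    interpret Q: primeideal Q P by fact
    assume "\<not> (\<exists>Q' \<in> F. con Q' \<subseteq> Q)"
    \<comment> \<open>The set \<open>T\<close> to be used is the image under \<open>red\<close> of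
      the complement of \<open>Q\<close>. It meets every member of \<open>F\<close> since no
      contraction lies inside \<open>Q\<close>.\<close>
    then have hit: "\<forall>Q' \<in> F. red ` (carrier P - Q) \<inter> Q' \<noteq> {}" by (auto simp: con_def)
    have one: "\<one>\<^bsub>?D\<^esub> \<in> red ` (carrier P - Q)"
      using primeideal_one_notin[OF Q(1)] by (intro image_eqI[of _ _ "\<one>\<^bsub>P\<^esub>"]) simp_all
    have mult: "\<forall>x \<in> red ` (carrier P - Q). \<forall>y \<in> red ` (carrier P - Q). x \<otimes>\<^bsub>?D\<^esub> y \<in> red ` (carrier P - Q)"
    proof (intro ballI)
      fix x y assume "x \<in> red ` (carrier P - Q)" "y \<in> red ` (carrier P - Q)"
      then obtain u v where uv: "u \<in> carrier P - Q" "v \<in> carrier P - Q" "x = red u" "y = red v" by blast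
      then have "u \<otimes>\<^bsub>P\<^esub> v \<in> carrier P - Q" "x \<otimes>\<^bsub>?D\<^esub> y = red (u \<otimes>\<^bsub>P\<^esub> v)" using Q.I_prime by auto
      then show "x \<otimes>\<^bsub>?D\<^esub> y \<in> red ` (carrier P - Q)" by blast
    qed
    have "red ` (carrier P - Q) \<subseteq> carrier ?D" by auto
    from F(3)[OF this one mult hit] obtain h where h: "h \<in> carrier P" "h \<notin> Q" "D.fraction_dvd (red f) (red h)"
      by blast
    obtain k :: nat and q where q: "q \<in> carrier ?D"
      "monom ?D (coeff ?D (red f) (deg R f)) 0 [^]\<^bsub>?D\<^esub> k \<otimes>\<^bsub>?D\<^esub> red h = red f \<otimes>\<^bsub>?D\<^esub> q"
      using D.fraction_dvd_lcoeff_pow[OF rc r0 red.hom_closed[OF h(1)] h(3)] unfolding deg by blast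
    \<comment> \<open>The identity over the quotient is lifted to \<open>P\<close>: the two sides
      then differ by an element of the kernel of \<open>red\<close>, which \<open>Q\<close>
      contains. So \<open>a\<close> to the power \<open>k\<close> times \<open>h\<close> lies in
      \<open>Q\<close>, although neither \<open>a\<close> nor \<open>h\<close> does.\<close>
    obtain q' where q': "q' \<in> carrier P" "red q' = q" using red_surj[OF q(1)] by blast
    define a where "a = monom P (lcoeff f) 0"
    have ac: "a \<in> carrier P" "a [^]\<^bsub>P\<^esub> k \<in> carrier P" using f by (simp_all add: a_def)
    have "red (a [^]\<^bsub>P\<^esub> k \<otimes>\<^bsub>P\<^esub> h) = red (f \<otimes>\<^bsub>P\<^esub> q')"
      using q(2) q' h f ac by (simp add: coeff_red flip: red_monom a_def)
    then have "red (a [^]\<^bsub>P\<^esub> k \<otimes>\<^bsub>P\<^esub> h \<ominus>\<^bsub>P\<^esub> f \<otimes>\<^bsub>P\<^esub> q') = \<zero>\<^bsub>?D\<^esub>"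
      using ac h f q' by (simp add: P.minus_eq D.P.r_neg del: red.hom_mult)
    then have "a [^]\<^bsub>P\<^esub> k \<otimes>\<^bsub>P\<^esub> h \<ominus>\<^bsub>P\<^esub> f \<otimes>\<^bsub>P\<^esub> q' \<in> Q"
      using red_eq_zero_iff Q(3) ac h f q' by auto
    moreover have "f \<otimes>\<^bsub>P\<^esub> q' \<in> Q" using Q.I_r_closed[OF Q(2) q'(1)] .
    ultimately have "(a [^]\<^bsub>P\<^esub> k \<otimes>\<^bsub>P\<^esub> h \<ominus>\<^bsub>P\<^esub> f \<otimes>\<^bsub>P\<^esub> q') \<oplus>\<^bsub>P\<^esub> f \<otimes>\<^bsub>P\<^esub> q' \<in> Q" by simp
    moreover have "(a [^]\<^bsub>P\<^esub> k \<otimes>\<^bsub>P\<^esub> h \<ominus>\<^bsub>P\<^esub> f \<otimes>\<^bsub>P\<^esub> q') \<oplus>\<^bsub>P\<^esub> f \<otimes>\<^bsub>P\<^esub> q' = a [^]\<^bsub>P\<^esub> k \<otimes>\<^bsub>P\<^esub> h"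
      using ac(2) h(1) f(1) q'(1) by algebra
    ultimately have "a [^]\<^bsub>P\<^esub> k \<in> Q" using Q.I_prime[OF ac(2) h(1)] h(2) by auto
    then show False using primeideal_nat_pow[OF Q(1) ac(1)] Q(4) a_def by blast
  qed
  then show ?thesis using F(1) con by (intro exI[of _ "con ` F"]) auto
qed

end

section \<open>Splitting along leading coefficients\<close>

context UP_cring
begin

lemma sub_lead_monom:
  assumes f: "f \<in> carrier P" "deg R f > 0"
  shows "deg R (f \<ominus>\<^bsub>P\<^esub> monom P (lcoeff f) (deg R f)) < deg R f"
proof -
  let ?m = "monom P (lcoeff f) (deg R f)"
  have "deg R (f \<oplus>\<^bsub>P\<^esub> \<ominus>\<^bsub>P\<^esub> ?m) < deg R f"
    by (rule deg_lcoeff_cancel) (use f in \<open>simp_all add: deg_monom_le\<close>)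
  then show ?thesis by (simp add: P.minus_eq)
qed

section \<open>Primes over constants, with at most one further polynomial\<close>

lemma const_mem_polys_over:
  assumes "primeideal p R" "f \<in> carrier P" "deg R f = 0" "coeff P f 0 \<in> p"
  shows "f \<in> polys_over p"
proof -
  interpret p: primeideal p R by fact
  have "coeff P f n \<in> p" for n
    using assms deg_aboveD[of f n] p.zero_closed by (cases n) simp_all
  then show ?thesis using assms(2) by (simp add: polys_over_def)
qed

lemma contraction_mem_zero_locus:
  assumes S: "S \<subseteq> carrier P" "\<And>f. f \<in> S \<Longrightarrow> deg R f = 0" and Q: "Q \<in> zero_locus P S"
  shows "{a \<in> carrier R. monom P a 0 \<in> Q} \<in> zero_locus R ((\<lambda>f. coeff P f 0) ` S)"
proof -
  have pQ: "primeideal Q P" and SQ: "S \<subseteq> Q" using Q by (simp_all add: zero_locus_iff)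
  have "monom P (coeff P f 0) 0 \<in> Q" if f: "f \<in> S" for f
    using deg_zero_impl_monom[of f] f S SQ by (metis subsetD)
  then show ?thesis
    using S(1) ring_hom_cring.primeideal_vimage[OF const_ring_hom_cring pQ]
    by (auto simp: zero_locus_iff)
qed

text \<open>A prime \<open>Q\<close> over \<open>S\<close> contracts to a prime of \<open>R\<close>
  over the constant terms. This lies above some \<open>p\<close> in \<open>F\<close>, and
  \<open>Q\<close> then contains the extension of \<open>p\<close>.\<close>

lemma consts_zero_locus_lower:
  assumes S: "S \<subseteq> carrier P" "\<And>f. f \<in> S \<Longrightarrow> deg R f = 0"
    and "finite_min_primes R ((\<lambda>f. coeff P f 0) ` S)"
  obtains F where "finite F" "\<And>p. p \<in> F \<Longrightarrow> primeideal p R \<and> S \<subseteq> polys_over p"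
    "\<And>Q. Q \<in> zero_locus P S \<Longrightarrow> \<exists>p \<in> F. polys_over p \<subseteq> Q"
proof -
  obtain F where F: "finite F" "F \<subseteq> zero_locus R ((\<lambda>f. coeff P f 0) ` S)"
    "\<And>p. p \<in> zero_locus R ((\<lambda>f. coeff P f 0) ` S) \<Longrightarrow> \<exists>q \<in> F. q \<subseteq> p"
    using assms(3) unfolding finite_min_primes_def by metis
  have "primeideal p R \<and> S \<subseteq> polys_over p" if p: "p \<in> F" for p
  proof -
    have "primeideal p R" "\<And>f. f \<in> S \<Longrightarrow> coeff P f 0 \<in> p"
      using subsetD[OF F(2) p] by (auto simp: zero_locus_iff)
    then show ?thesis using S const_mem_polys_over by blast
  qed
  moreover have "\<exists>p \<in> F. polys_over p \<subseteq> Q" if Q: "Q \<in> zero_locus P S" for Q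
  proof -
    obtain p where p: "p \<in> F" "p \<subseteq> {a \<in> carrier R. monom P a 0 \<in> Q}"
      using F(3)[OF contraction_mem_zero_locus[OF S Q]] by blast
    have "polys_over p \<subseteq> Q"
      by (rule polys_over_subset) (use Q p(2) in \<open>auto simp: zero_locus_iff\<close>)
    with p(1) show ?thesis by blast
  qed
  ultimately show ?thesis using that F(1) by blast
qed

lemma UP_prime_quotientI: "primeideal p R \<Longrightarrow> UP_prime_quotient R p"
  by (simp add: UP_prime_quotient_def UP_cring_def R.cring_axioms)

text \<open>The extensions of the primes \<open>p\<close> are prime and contain \<open>S\<close>, so
  they form the required finite set.\<close>

lemma finite_min_primes_consts:
  assumes S: "S \<subseteq> carrier P" "\<And>f. f \<in> S \<Longrightarrow> deg R f = 0"
    and "finite_min_primes R ((\<lambda>f. coeff P f 0) ` S)"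
  shows "finite_min_primes P S"
proof -
  obtain F where F: "finite F" "\<And>p. p \<in> F \<Longrightarrow> primeideal p R \<and> S \<subseteq> polys_over p"
    "\<And>Q. Q \<in> zero_locus P S \<Longrightarrow> \<exists>p \<in> F. polys_over p \<subseteq> Q"
    using consts_zero_locus_lower[OF assms] by metis
  show ?thesis
    unfolding finite_min_primes_def
  proof (intro exI[of _ "polys_over ` F"] conjI ballI)
    show "polys_over ` F \<subseteq> zero_locus P S"
      using F(2) UP_prime_quotient.primeideal_polys_over[OF UP_prime_quotientI, folded P_def]
      by (auto simp: zero_locus_iff subset_iff)
  qed (use F(1,3) in auto)
qed

lemma primes_over_consts_insert:
  assumes S: "S \<subseteq> carrier P" "\<And>g. g \<in> S \<Longrightarrow> deg R g = 0" and f: "f \<in> carrier P"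
    and fin: "finite_min_primes R ((\<lambda>g. coeff P g 0) ` S)"
  obtains F where "finite F" "F \<subseteq> zero_locus P (insert f S)"
    "\<And>Q. Q \<in> zero_locus P (insert f S) \<Longrightarrow> monom P (lcoeff f) 0 \<notin> Q \<Longrightarrow> \<exists>Q' \<in> F. Q' \<subseteq> Q"
proof -
  obtain F where F: "finite F" "\<And>p. p \<in> F \<Longrightarrow> primeideal p R \<and> S \<subseteq> polys_over p"
    "\<And>Q. Q \<in> zero_locus P S \<Longrightarrow> \<exists>p \<in> F. polys_over p \<subseteq> Q"
    using consts_zero_locus_lower[OF S fin] by metis
  let ?a = "monom P (lcoeff f) 0"
  \<comment> \<open>The conclusion of \<open>primes_over_lcoeff_notin\<close> as a predicate, so
    that one set \<open>G p\<close> can be chosen for each \<open>p\<close>.\<close>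
  define good where "good p G \<longleftrightarrow>
    finite G \<and> (\<forall>Q \<in> G. primeideal Q P \<and> f \<in> Q \<and> polys_over p \<subseteq> Q) \<and>
    (\<forall>Q. primeideal Q P \<and> f \<in> Q \<and> polys_over p \<subseteq> Q \<and> ?a \<notin> Q \<longrightarrow> (\<exists>Q' \<in> G. Q' \<subseteq> Q))" for p G
  have "\<exists>G. good p G" if p: "p \<in> F" for p
  proof (cases "lcoeff f \<in> p")
    \<comment> \<open>Every prime above \<open>polys_over p\<close> now contains \<open>?a\<close>,
      so there is nothing to bound from below and the empty set works.\<close>
    case True
    have "?a \<in> polys_over p" using True f F(2)[OF p] by (intro const_mem_polys_over) auto
    then have "good p {}" by (auto simp: good_def)
    then show ?thesis by blast
  next
    case False
    have "UP_prime_quotient R p" using F(2)[OF p] UP_prime_quotientI by blast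
    from UP_prime_quotient.primes_over_lcoeff_notin[OF this, folded P_def, OF f False]
    show ?thesis unfolding good_def .
  qed
  then obtain G where G: "\<And>p. p \<in> F \<Longrightarrow> good p (G p)" by metis
  show ?thesis
  proof (rule that)
    show "finite (\<Union>p \<in> F. G p)" using F(1) G by (auto simp: good_def)
    show "(\<Union>p \<in> F. G p) \<subseteq> zero_locus P (insert f S)"
    proof
      fix Q assume "Q \<in> (\<Union>p \<in> F. G p)"
      then obtain p where p: "p \<in> F" "Q \<in> G p" by blast
      then have "primeideal Q P \<and> f \<in> Q \<and> polys_over p \<subseteq> Q" using G[OF p(1)] by (simp add: good_def)
      then show "Q \<in> zero_locus P (insert f S)" using F(2)[OF p(1)] by (auto simp: zero_locus_iff)
    qed
    fix Q assume Q: "Q \<in> zero_locus P (insert f S)" "?a \<notin> Q"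
    then have "primeideal Q P" "f \<in> Q" "Q \<in> zero_locus P S" by (simp_all add: zero_locus_iff)
    moreover from this obtain p where p: "p \<in> F" "polys_over p \<subseteq> Q" using F(3) by blast
    ultimately have "\<exists>Q' \<in> G p. Q' \<subseteq> Q" using G[OF p(1)] Q(2) by (simp add: good_def)
    then show "\<exists>Q' \<in> (\<Union>p \<in> F. G p). Q' \<subseteq> Q" using p(1) by blast
  qed
qed

text \<open>Every step of the induction splits the zero locus along the leading coefficient \<open>a\<close> of a
  nonconstant polynomial \<open>f\<close>. Where \<open>a\<close> vanishes, \<open>f\<close> can be replaced by a polynomial
  of smaller degree; where it does not, any other nonconstant polynomial can be reduced modulo \<open>f\<close>.\<close>

lemma finite_min_primes_UP:
  assumes R: "\<And>C. finite C \<Longrightarrow> C \<subseteq> carrier R \<Longrightarrow> finite_min_primes R C"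
    and S: "finite S" "S \<subseteq> carrier P"
  shows "finite_min_primes P S"
  using S
\<comment> \<open>The measure is the total degree, which adding a constant such as \<open>a\<close>
  leaves unchanged.\<close>
proof (induction "\<Sum>f \<in> S. deg R f" arbitrary: S rule: less_induct)
  case less
  note S = less.prems
  have coeff0: "finite_min_primes R ((\<lambda>g. coeff P g 0) ` T)" if "T \<subseteq> S" for T
    using that S finite_subset[OF that] by (intro R) auto
  show ?case
  proof (cases "\<forall>f \<in> S. deg R f = 0")
    case True
    then show ?thesis using S(2) coeff0 by (intro finite_min_primes_consts) auto
  next
    case False
    \<comment> \<open>Least positive degree ensures that a remainder modulo \<open>f\<close> has
      smaller degree than whichever nonconstant \<open>g\<close> it replaces.\<close>
    obtain f where f: "f \<in> S" "deg R f > 0" and fmin: "\<And>g. g \<in> S \<Longrightarrow> deg R g > 0 \<Longrightarrow> deg R f \<le> deg R g"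
      using ex_has_least_nat[of "\<lambda>f. f \<in> S \<and> deg R f > 0" _ "deg R"] False by blast
    have fc: "f \<in> carrier P" using f S by blast
    define a where "a = monom P (lcoeff f) 0"
    define f' where "f' = f \<ominus>\<^bsub>P\<^esub> monom P (lcoeff f) (deg R f)"
    have ac: "a \<in> carrier P" "deg R a = 0" and f'c: "f' \<in> carrier P" using fc by (simp_all add: a_def f'_def)
    have f'deg: "deg R f' < deg R f" unfolding f'_def by (rule sub_lead_monom) (use fc f in auto)
    have "finite_min_primes P (insert a (insert f' (S - {f})))"
    proof (rule less.hyps)
      \<comment> \<open>Only an inequality, because \<open>a\<close> or \<open>f'\<close> may
        already belong to the set.\<close>
      have "(\<Sum>g \<in> insert a (insert f' (S - {f})). deg R g) \<le> deg R f' + (\<Sum>g \<in> S - {f}. deg R g)"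
        using S(1) ac(2) by (simp add: sum.insert_if)
      also have "\<dots> < (\<Sum>g \<in> S. deg R g)" using f'deg f S(1) by (simp add: sum.remove)
      finally show "(\<Sum>g \<in> insert a (insert f' (S - {f})). deg R g) < (\<Sum>g \<in> S. deg R g)" .
    qed (use S ac f'c in auto)
    moreover have "zero_locus P (insert a (insert f' (S - {f}))) = zero_locus P (insert a S)"
    proof -
      \<comment> \<open>The two differ by the leading term of \<open>f\<close>, a multiple of
        \<open>a\<close>.\<close>
      have "f' \<in> Q \<longleftrightarrow> f \<in> Q" if Q: "primeideal Q P" "a \<in> Q" for Q
      proof -
        interpret Q: primeideal Q P by fact
        define m where "m = monom P (lcoeff f) (deg R f)"
        have m: "m \<in> Q" "m \<in> carrier P"
          using Q(2) fc Q.I_r_closed monom_eq_const_mult[of "lcoeff f" "deg R f"] by (simp_all add: a_def m_def)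
        have "f = f' \<oplus>\<^bsub>P\<^esub> m" "f' = f \<oplus>\<^bsub>P\<^esub> \<ominus>\<^bsub>P\<^esub> m"
          using fc m(2) unfolding f'_def m_def[symmetric] by algebra+
        then show ?thesis using m Q.a_closed Q.a_inv_closed by metis
      qed
      then show ?thesis using f(1) unfolding zero_locus_def Spec_def by blast
    qed
    ultimately have a: "finite_min_primes P (insert a S)" by (simp add: finite_min_primes_def)
    show ?thesis
    proof (cases "\<exists>g \<in> S. g \<noteq> f \<and> deg R g > 0")
      case True
      then obtain g where g: "g \<in> S" "g \<noteq> f" "deg R g > 0" by blast
      then have gc: "g \<in> carrier P" using S by blast
      have f0: "f \<noteq> \<zero>\<^bsub>P\<^esub>" using f by auto
      obtain q r and k :: nat where d: "q \<in> carrier P" "r \<in> carrier P"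
        "a [^]\<^bsub>P\<^esub> k \<otimes>\<^bsub>P\<^esub> g = f \<otimes>\<^bsub>P\<^esub> q \<oplus>\<^bsub>P\<^esub> r" "r = \<zero>\<^bsub>P\<^esub> \<or> deg R r < deg R f"
        using pseudo_division[OF gc fc f0] unfolding a_def by metis
      have rdeg: "deg R r < deg R g" using d(4) f(2) fmin[OF g(1,3)] by auto
      have "finite_min_primes P (insert r (S - {g}))"
      proof (rule less.hyps)
        have "(\<Sum>h \<in> insert r (S - {g}). deg R h) \<le> deg R r + (\<Sum>h \<in> S - {g}. deg R h)"
          using S(1) by (simp add: sum.insert_if)
        also have "\<dots> < (\<Sum>h \<in> S. deg R h)" using rdeg g S(1) by (simp add: sum.remove)
        finally show "(\<Sum>h \<in> insert r (S - {g}). deg R h) < (\<Sum>h \<in> S. deg R h)" .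
      qed (use S d in auto)
      then obtain F where F: "finite F" "F \<subseteq> zero_locus P (insert r (S - {g}))"
        "\<And>Q. Q \<in> zero_locus P (insert r (S - {g})) \<Longrightarrow> \<exists>Q' \<in> F. Q' \<subseteq> Q"
        unfolding finite_min_primes_def by metis
      \<comment> \<open>Modulo \<open>f\<close>, the remainder \<open>r\<close> is a power of
        \<open>a\<close> times \<open>g\<close>; a prime that avoids \<open>a\<close> therefore
        contains both or neither.\<close>
      have iff: "Q \<in> zero_locus P (insert r (S - {g})) \<longleftrightarrow> Q \<in> zero_locus P S" if aQ: "a \<notin> Q" for Q
      proof -
        have "r \<in> Q \<longleftrightarrow> g \<in> Q" if Q: "primeideal Q P" "f \<in> Q"
        proof -
          interpret Q: primeideal Q P by fact
          have ak: "a [^]\<^bsub>P\<^esub> k \<in> carrier P" "a [^]\<^bsub>P\<^esub> k \<notin> Q"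
            using ac(1) aQ primeideal_nat_pow[OF Q(1) ac(1)] by (blast intro: P.nat_pow_closed)+
          have fq: "f \<otimes>\<^bsub>P\<^esub> q \<in> Q" using Q.I_r_closed[OF Q(2) d(1)] .
          have r: "r = a [^]\<^bsub>P\<^esub> k \<otimes>\<^bsub>P\<^esub> g \<oplus>\<^bsub>P\<^esub> \<ominus>\<^bsub>P\<^esub> (f \<otimes>\<^bsub>P\<^esub> q)"
            unfolding d(3) using d(1,2) fc by algebra
          show ?thesis
          proof
            assume "r \<in> Q"
            then have "a [^]\<^bsub>P\<^esub> k \<otimes>\<^bsub>P\<^esub> g \<in> Q" unfolding d(3) using fq by simp
            then show "g \<in> Q" using Q.I_prime[OF ak(1) gc] ak(2) by blast
          next
            assume "g \<in> Q"
            then have "a [^]\<^bsub>P\<^esub> k \<otimes>\<^bsub>P\<^esub> g \<in> Q" using Q.I_l_closed ak(1) by blast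
            then show "r \<in> Q" using fq Q.a_closed Q.a_inv_closed by (subst r) blast
          qed
        qed
        then show ?thesis using f(1) g(1,2) unfolding zero_locus_iff by blast
      qed
      show ?thesis
      \<comment> \<open>Members of \<open>F\<close> that contain \<open>a\<close> may miss
        \<open>g\<close> and are discarded. None of them lies below a prime that avoids
        \<open>a\<close>, so the lower bounds remain.\<close>
      proof (rule finite_min_primes_split[OF a])
        show "finite {Q \<in> F. a \<notin> Q}" using F(1) by simp
        show "{Q \<in> F. a \<notin> Q} \<subseteq> zero_locus P S" using F(2) iff by blast
        show "\<exists>Q' \<in> {Q \<in> F. a \<notin> Q}. Q' \<subseteq> Q" if "Q \<in> zero_locus P S" "a \<notin> Q" for Q
          using that iff F(3) by blast
      qed
    next
      \<comment> \<open>Now \<open>f\<close> is the only nonconstant member of \<open>S\<close>,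
        which is the situation of \<open>primes_over_consts_insert\<close>.\<close>
      case False
      have ins: "insert f (S - {f}) = S" using f(1) by blast
      have "S - {f} \<subseteq> carrier P" "\<And>g. g \<in> S - {f} \<Longrightarrow> deg R g = 0" using S(2) False by auto
      from primes_over_consts_insert[OF this fc coeff0[OF Diff_subset], unfolded ins]
      obtain F where "finite F" "F \<subseteq> zero_locus P S"
        "\<And>Q. Q \<in> zero_locus P S \<Longrightarrow> a \<notin> Q \<Longrightarrow> \<exists>Q' \<in> F. Q' \<subseteq> Q"
        unfolding a_def by metis
      then show ?thesis by (rule finite_min_primes_split[OF a])
    qed
  qed
qed

lemma FGFC_ring_UP_iff: "FGFC_ring R \<longleftrightarrow> FGFC_ring P"
proof
  assume "FGFC_ring R"
  then show "FGFC_ring P"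
    unfolding R.FGFC_ring_iff P.FGFC_ring_iff using finite_min_primes_UP by blast
next
  assume fg: "FGFC_ring P"
  have "finite_min_primes R S" if S: "finite S" "S \<subseteq> carrier R" for S
  proof (rule finite_min_primes_retract[OF const_ring_hom_cring coeff_0_ring_hom_cring _ S(2)])
    have "(\<lambda>a. monom P a 0) ` S \<subseteq> carrier P" using S(2) by auto
    then show "finite_min_primes P ((\<lambda>a. monom P a 0) ` S)"
      using fg S(1) unfolding P.FGFC_ring_iff by blast
  qed simp
  then show "FGFC_ring R" unfolding R.FGFC_ring_iff by blast
qed

end

theorem theorem2p3:
  fixes R :: "('a, 'm) ring_scheme"
  assumes "cring R"
  shows "FGFC_ring R \<longleftrightarrow> FGFC_ring (UP R)"
proof -
  interpret UP_cring R "UP R" using assms by (simp add: UP_cring_def)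
  show ?thesis by (rule FGFC_ring_UP_iff)
qed

end
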